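(* Let $\mathcal N\subseteq\mathcal X^2$ be a symmetric neighbor relation, $Q$ a probability measure on $\mathcal Z$, and $P_{Z|X}$ a Markov kernel with $P_{Z|X}(\cdot|x)\ll Q$ for all $x$, which is $(\varepsilon,\delta)$-DP with respect to $\mathcal N$. Let $\tilde\varepsilon\in(0,1]$, $\tilde\delta\in(0,1/3]$, and $\alpha>1$ with $$\alpha\le \frac{e^{-4.2}\,\tilde\delta\,\tilde\varepsilon^2}{-\ln\tilde\delta}+1.$$ Then the PPR-compressed mechanism $x\mapsto((Z_i)_{i\ge1},K)$ with parameter $\alpha$ is $(\alpha\varepsilon+\tilde\varepsilon,\;2(\delta+\tilde\delta))$-DP with respect to $\mathcal N$.
   Context: A Markov kernel $P_{W|X}$ is $(\varepsilon,\delta)$-DP w.r.t. a symmetric relation $\mathcal N\subseteq\mathcal X^2$ if $\Pr(W\in S\mid X=x)\le e^{\varepsilon}\Pr(W\in S\mid X=x')+\delta$ for all $(x,x')\in\mathcal N$ and measurable $S$. PPR: let $Z_1,Z_2,\ldots$ be i.i.d. $\sim Q$, independent of the points $T_1\le T_2\le\cdots$ of a rate-$1$ Poisson process on $[0,\infty)$. For input $x$, with $P=P_{Z|X}(\cdot|x)$, set $\tilde T_i:=T_i(\frac{\mathrm dP}{\mathrm dQ}(Z_i))^{-1}$ ($:=\infty$ if the derivative is $0$, $\infty^{-\alpha}:=0$), and draw $K$ with $\Pr(K=k\mid (Z_i,T_i)_i)=\tilde T_k^{-\alpha}/\sum_i\tilde T_i^{-\alpha}$ (fresh randomness for each input). The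 PPR-compressed mechanism is the kernel $x\mapsto((Z_i)_{i\ge1},K)$; the shared sequence $(Z_i)$ does not depend on $x$. *)

theory Defs
  imports "HOL-Probability.Probability"
begin

definition dp :: "real \<Rightarrow> real \<Rightarrow> ('x \<times> 'x) set \<Rightarrow> ('x \<Rightarrow> 'w measure) \<Rightarrow> bool" where
  "dp eps delta N W \<longleftrightarrow>
     (\<forall>(x, x') \<in> N. \<forall>S \<in> sets (W x). measure (W x) S \<le> exp eps * measure (W x') S + delta)"

text \<open>Exponential(1) distribution on the reals (inter-arrival times of a rate-1 Poisson process).\<close>
definition exp1 :: "real measure" where
  "exp1 = density lborel (exponential_density 1)"

text \<open>Points of the rate-1 Poisson process: T_k = E_0 + ... + E_k (0-indexed).\<close>
definition ppr_arrival :: "real stream \<Rightarrow> nat \<Rightarrow> real" where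
  "ppr_arrival es k = (\<Sum>j\<le>k. es !! j)"

text \<open>Weight  Ttilde_k^(-alpha) = (dP/dQ(Z_k))^alpha / T_k^alpha,
  which is 0 when the derivative is 0 (Ttilde_k = infinity).\<close>
definition ppr_weight :: "'z measure \<Rightarrow> 'z measure \<Rightarrow> real \<Rightarrow> 'z stream \<Rightarrow> real stream \<Rightarrow> nat \<Rightarrow> real" where
  "ppr_weight Q P alpha zs es k =
     (enn2real (RN_deriv Q P (zs !! k)) powr alpha) / (ppr_arrival es k powr alpha)"

text \<open>Conditional law of the index K given (Z_i, T_i)_i; on the null event where the
  normalising sum is 0 or infinite an arbitrary fixed law is used.\<close>
definition ppr_K_dist :: "'z measure \<Rightarrow> 'z measure \<Rightarrow> real \<Rightarrow> 'z stream \<Rightarrow> real stream \<Rightarrow> nat measure" where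
  "ppr_K_dist Q P alpha zs es =
     (let w = ppr_weight Q P alpha zs es;
          s = (\<Sum>k. ennreal (w k))
      in if 0 < s \<and> s < \<infinity>
         then density (count_space UNIV) (\<lambda>k. ennreal (w k) / s)
         else return (count_space UNIV) 0)"

definition ppr_mech :: "'z measure \<Rightarrow> ('x \<Rightarrow> 'z measure) \<Rightarrow> real \<Rightarrow> 'x \<Rightarrow> ('z stream \<times> nat) measure" where
  "ppr_mech Q PZX alpha x =
     bind (stream_space Q \<Otimes>\<^sub>M stream_space exp1)
       (\<lambda>(zs, es). distr (ppr_K_dist Q (PZX x) alpha zs es)
                     (stream_space Q \<Otimes>\<^sub>M count_space UNIV) (\<lambda>k. (zs, k)))"

end

theory Submission
  imports Defs
begin

text \<open>
  The privacy bound already holds for the mechanism that also reveals the arrival times. Write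
  \<open>f\<close>, \<open>g\<close> for the densities of two neighbouring inputs and \<open>S f\<close>, \<open>S g\<close> for the normalising sums.
  Given the points, the two selection probabilities of index \<open>k\<close> differ by the factor
  \<open>(f z / g z) powr alpha * (S g / S f)\<close> with \<open>z = Z k\<close>.

  Fix \<open>theta = delta' / 2\<close>. With probability at least \<open>1 - theta\<close> no point has \<open>T k \<le> theta * f (Z k)\<close>,
  and the sum over the remaining points has mean \<open>c = theta powr (1 - alpha) / (alpha - 1)\<close>, which does
  not depend on \<open>f\<close>, and variance at most \<open>1 / theta\<close> times a power of \<open>theta\<close> that cancels against
  \<open>c\<^sup>2\<close>. As \<open>alpha - 1\<close> is small compared with \<open>delta' * eps'\<close>, Chebyshev's inequality gives
  \<open>S g \<le> exp eps' * S f\<close> outside an event of probability \<open>2 * delta'\<close>.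

  The part of \<open>f\<close> that exceeds \<open>exp eps * g\<close> has mass at most \<open>delta\<close>; by Bernoulli's inequality and
  Campbell's formula it contributes at most \<open>alpha * delta / (1 - eps' / 3)\<close>, hence at most \<open>2 * delta\<close>.
\<close>

section \<open>The marked Poisson process: shift identities and the law of a single point\<close>

lemma sets_exp1 [simp, measurable_cong]: "sets exp1 = sets borel"
  by (simp add: exp1_def)

lemma space_exp1 [simp]: "space exp1 = UNIV"
  by (simp add: exp1_def)

lemma prob_space_exp1: "prob_space exp1"
  unfolding exp1_def by (rule prob_space_exponential_density) simp

lemma ppr_arrival_0: "ppr_arrival es 0 = shd es"
  by (simp add: ppr_arrival_def)

lemma ppr_arrival_Suc: "ppr_arrival (e ## es) (Suc k) = e + ppr_arrival es k"
  unfolding ppr_arrival_def by (subst sum.atMost_Suc_shift) simp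

text \<open>Lets a sum over the points after arrival \<open>k\<close> be read as a sum over a
  restarted process whose clock begins at the time of arrival \<open>k\<close>.\<close>

lemma ppr_arrival_add: "ppr_arrival es (Suc k + m) = ppr_arrival es k + ppr_arrival (sdrop (Suc k) es) m"
proof (induction k arbitrary: es)
  case 0
  show ?case by (cases es) (simp add: ppr_arrival_Suc ppr_arrival_0)
next
  case (Suc k)
  show ?case
    using Suc[of "stl es"] by (cases es) (simp add: ppr_arrival_Suc)
qed

lemma measurable_ppr_arrival [measurable]:
  "(\<lambda>es. ppr_arrival es k) \<in> borel_measurable (stream_space exp1)"
proof -
  have [measurable]: "(\<lambda>es. es !! j) \<in> borel_measurable (stream_space exp1)" for j
    using measurable_snth[of j exp1] by (simp cong: measurable_cong_sets)
  show ?thesis unfolding ppr_arrival_def by measurable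
qed

abbreviation ppr_space :: "'z measure \<Rightarrow> ('z stream \<times> real stream) measure" where
  "ppr_space Q \<equiv> stream_space Q \<Otimes>\<^sub>M stream_space exp1"

lemma prob_space_ppr_space:
  assumes "prob_space Q"
  shows "prob_space (ppr_space Q)"
proof -
  interpret Q: prob_space Q by fact
  interpret E: prob_space exp1 by (rule prob_space_exp1)
  interpret SQ: prob_space "stream_space Q" by (rule Q.prob_space_stream_space)
  interpret SE: prob_space "stream_space exp1" by (rule E.prob_space_stream_space)
  interpret pair_prob_space "stream_space Q" "stream_space exp1" ..
  show ?thesis by (rule P.prob_space_axioms)
qed

text \<open>One-step recursion for the process: marks and gaps live in two separate i.i.d. streams,
  and Fubini allows both heads to be peeled off together. It drives the induction over the index of
  an arrival.\<close>

lemma nn_integral_ppr_space_Stream: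
  assumes "prob_space Q" and [measurable]: "F \<in> borel_measurable (ppr_space Q)"
  shows "(\<integral>\<^sup>+\<omega>. F \<omega> \<partial>ppr_space Q) =
    (\<integral>\<^sup>+e. (\<integral>\<^sup>+z. (\<integral>\<^sup>+\<omega>. F (z ## fst \<omega>, e ## snd \<omega>) \<partial>ppr_space Q) \<partial>Q) \<partial>exp1)"
proof -
  interpret Q: prob_space Q by fact
  interpret E: prob_space exp1 by (rule prob_space_exp1)
  interpret SQ: prob_space "stream_space Q" by (rule Q.prob_space_stream_space)
  interpret SE: prob_space "stream_space exp1" by (rule E.prob_space_stream_space)
  interpret p1: pair_sigma_finite "stream_space Q" exp1 ..
  interpret p2: pair_sigma_finite Q exp1 ..
  have "(\<integral>\<^sup>+\<omega>. F \<omega> \<partial>ppr_space Q) = (\<integral>\<^sup>+zs. \<integral>\<^sup>+es. F (zs, es) \<partial>stream_space exp1 \<partial>stream_space Q)"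
    by (simp add: SE.nn_integral_fst)
  also have "\<dots> = (\<integral>\<^sup>+zs. \<integral>\<^sup>+e. \<integral>\<^sup>+es. F (zs, e ## es) \<partial>stream_space exp1 \<partial>exp1 \<partial>stream_space Q)"
    by (intro nn_integral_cong E.nn_integral_stream_space) measurable
  also have "\<dots> = (\<integral>\<^sup>+e. \<integral>\<^sup>+zs. \<integral>\<^sup>+es. F (zs, e ## es) \<partial>stream_space exp1 \<partial>stream_space Q \<partial>exp1)"
    by (intro p1.Fubini'[symmetric]) measurable
  also have "\<dots> = (\<integral>\<^sup>+e. \<integral>\<^sup>+z. \<integral>\<^sup>+zs. \<integral>\<^sup>+es. F (z ## zs, e ## es) \<partial>stream_space exp1 \<partial>stream_space Q \<partial>Q \<partial>exp1)"
    by (intro nn_integral_cong Q.nn_integral_stream_space) measurable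
  also have "\<dots> = (\<integral>\<^sup>+e. (\<integral>\<^sup>+z. (\<integral>\<^sup>+\<omega>. F (z ## fst \<omega>, e ## snd \<omega>) \<partial>ppr_space Q) \<partial>Q) \<partial>exp1)"
  proof (intro nn_integral_cong)
    fix e z assume [measurable]: "e \<in> space exp1" "z \<in> space Q"
    have "(\<lambda>\<omega>. F (z ## fst \<omega>, e ## snd \<omega>)) \<in> borel_measurable (ppr_space Q)"
      by measurable
    from SE.nn_integral_fst[OF this]
    show "(\<integral>\<^sup>+zs. \<integral>\<^sup>+es. F (z ## zs, e ## es) \<partial>stream_space exp1 \<partial>stream_space Q) =
      (\<integral>\<^sup>+\<omega>. F (z ## fst \<omega>, e ## snd \<omega>) \<partial>ppr_space Q)" by simp
  qed
  finally show ?thesis .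
qed

text \<open>The exponential density is written as the first Erlang density so that the base case and
  the convolution step of the induction over arrivals use one family.\<close>

lemma nn_integral_exp1:
  assumes [measurable]: "F \<in> borel_measurable borel"
  shows "(\<integral>\<^sup>+e. F e \<partial>exp1) = (\<integral>\<^sup>+e. ennreal (erlang_density 0 1 e) * F e \<partial>lborel)"
  unfolding exp1_def by (subst nn_integral_density) (auto simp: exponential_density_def)

text \<open>The exponential series: for \<open>t \<ge> 0\<close> the Erlang densities are the
  Poisson probabilities with mean \<open>t\<close>. Summed over all arrivals they give Lebesgue
  measure on the half line as intensity, which is where the rate 1 enters.\<close>

lemma suminf_erlang_density:
  "(\<Sum>k. ennreal (erlang_density k 1 t)) = indicator {0..} t"
proof (cases "t < 0")
  case True
  then show ?thesis by (simp add: erlang_density_def)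
next
  case False
  have "(\<lambda>k. t ^ k /\<^sub>R fact k * exp (- t)) sums (exp t * exp (- t))"
    by (intro sums_mult2 exp_converges)
  then have "(\<lambda>k. erlang_density k 1 t) sums 1"
    using False by (simp add: erlang_density_def divide_inverse mult_ac exp_minus)
  then have "(\<Sum>k. ennreal (erlang_density k 1 t)) = ennreal 1"
    by (intro suminf_ennreal_eq) auto
  with False show ?thesis by simp
qed

text \<open>The mark of arrival \<open>k\<close>, its time and the process after it are independent,
  with laws \<open>Q\<close>, Erlang and \<open>ppr_space Q\<close>. The offset \<open>s\<close>
  carries the induction: removing the first gap \<open>e\<close> replaces \<open>s\<close> by
  \<open>s + e\<close>.\<close>

lemma nn_integral_shifted_arrival:
  assumes Q: "prob_space Q"
    and Psi [measurable]: "Psi \<in> borel_measurable (Q \<Otimes>\<^sub>M borel \<Otimes>\<^sub>M ppr_space Q)"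
  shows "(\<integral>\<^sup>+\<omega>. Psi (fst \<omega> !! k, s + ppr_arrival (snd \<omega>) k,
                     (sdrop (Suc k) (fst \<omega>), sdrop (Suc k) (snd \<omega>))) \<partial>ppr_space Q) =
    (\<integral>\<^sup>+t. ennreal (erlang_density k 1 t) * (\<integral>\<^sup>+z. \<integral>\<^sup>+\<omega>. Psi (z, s + t, \<omega>) \<partial>ppr_space Q \<partial>Q) \<partial>lborel)"
proof -
  interpret Q: prob_space Q by fact
  interpret M: prob_space "ppr_space Q" by (rule prob_space_ppr_space) fact
  let ?F = "\<lambda>t. \<integral>\<^sup>+z. \<integral>\<^sup>+\<omega>. Psi (z, t, \<omega>) \<partial>ppr_space Q \<partial>Q"
  show ?thesis
  proof (induction k arbitrary: s)
    case 0
    have "(\<integral>\<^sup>+\<omega>. Psi (fst \<omega> !! 0, s + ppr_arrival (snd \<omega>) 0,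
        (sdrop (Suc 0) (fst \<omega>), sdrop (Suc 0) (snd \<omega>))) \<partial>ppr_space Q) = (\<integral>\<^sup>+e. ?F (s + e) \<partial>exp1)"
      by (subst nn_integral_ppr_space_Stream[OF Q]) (simp_all add: ppr_arrival_0)
    then show ?case by (simp add: nn_integral_exp1)
  next
    case (Suc k)
    have "(\<integral>\<^sup>+\<omega>. Psi (fst \<omega> !! Suc k, s + ppr_arrival (snd \<omega>) (Suc k),
        (sdrop (Suc (Suc k)) (fst \<omega>), sdrop (Suc (Suc k)) (snd \<omega>))) \<partial>ppr_space Q) =
      (\<integral>\<^sup>+e. \<integral>\<^sup>+z. (\<integral>\<^sup>+\<omega>. Psi (fst \<omega> !! k, (s + e) + ppr_arrival (snd \<omega>) k,
                     (sdrop (Suc k) (fst \<omega>), sdrop (Suc k) (snd \<omega>))) \<partial>ppr_space Q) \<partial>Q \<partial>exp1)"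
      by (subst nn_integral_ppr_space_Stream[OF Q]) (simp_all add: ppr_arrival_Suc add.assoc)
    also have "\<dots> = (\<integral>\<^sup>+e. \<integral>\<^sup>+t. ennreal (erlang_density k 1 t) * ?F (s + e + t) \<partial>lborel \<partial>exp1)"
      unfolding Suc.IH by (simp add: Q.emeasure_space_1)
    also have "\<dots> = (\<integral>\<^sup>+e. ennreal (erlang_density 0 1 e) *
        (\<integral>\<^sup>+t. ennreal (erlang_density k 1 t) * ?F (s + e + t) \<partial>lborel) \<partial>lborel)"
      by (rule nn_integral_exp1) measurable
    \<comment> \<open>Translating \<open>t\<close> by \<open>e\<close> moves the shift from
      \<open>?F\<close> to the Erlang density. After Fubini the integral over \<open>e\<close> is
      then a convolution of Erlang densities.\<close>
    also have "\<dots> = (\<integral>\<^sup>+e. ennreal (erlang_density 0 1 e) *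
        (\<integral>\<^sup>+t. ennreal (erlang_density k 1 (t - e)) * ?F (s + t) \<partial>lborel) \<partial>lborel)"
    proof (rule nn_integral_cong, rule arg_cong2[where f="(*)", OF refl])
      fix e :: real
      show "(\<integral>\<^sup>+t. ennreal (erlang_density k 1 t) * ?F (s + e + t) \<partial>lborel) =
        (\<integral>\<^sup>+t. ennreal (erlang_density k 1 (t - e)) * ?F (s + t) \<partial>lborel)"
        by (subst nn_integral_real_affine[where c=1 and t="- e"]) (auto simp: algebra_simps)
    qed
    also have "\<dots> = (\<integral>\<^sup>+e. \<integral>\<^sup>+t. ennreal (erlang_density k 1 (t - e)) *
        ennreal (erlang_density 0 1 e) * ?F (s + t) \<partial>lborel \<partial>lborel)"
      by (simp add: nn_integral_cmult[symmetric] mult_ac)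
    also have "\<dots> = (\<integral>\<^sup>+t. \<integral>\<^sup>+e. ennreal (erlang_density k 1 (t - e)) *
        ennreal (erlang_density 0 1 e) * ?F (s + t) \<partial>lborel \<partial>lborel)"
      by (intro lborel_pair.Fubini') measurable
    also have "\<dots> = (\<integral>\<^sup>+t. (\<integral>\<^sup>+e. ennreal (erlang_density k 1 (t - e)) *
        ennreal (erlang_density 0 1 e) \<partial>lborel) * ?F (s + t) \<partial>lborel)"
      by (simp add: nn_integral_multc)
    also have "\<dots> = (\<integral>\<^sup>+t. ennreal (erlang_density (Suc k) 1 t) * ?F (s + t) \<partial>lborel)"
      using convolution_erlang_density[of 1 k 0] by (simp add: fun_eq_iff)
    finally show ?case .
  qed
qed

text \<open>The expected number of arrivals in \<open>dt\<close> is \<open>dt\<close>, and the process after an arrival is a fresh copy.\<close>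

lemma nn_integral_suminf_shifted_arrival:
  assumes Q: "prob_space Q"
    and Psi [measurable]: "Psi \<in> borel_measurable (Q \<Otimes>\<^sub>M borel \<Otimes>\<^sub>M ppr_space Q)"
  shows "(\<integral>\<^sup>+\<omega>. (\<Sum>k. Psi (fst \<omega> !! k, s + ppr_arrival (snd \<omega>) k,
                     (sdrop (Suc k) (fst \<omega>), sdrop (Suc k) (snd \<omega>)))) \<partial>ppr_space Q) =
    (\<integral>\<^sup>+t. indicator {0..} t * (\<integral>\<^sup>+z. \<integral>\<^sup>+\<omega>. Psi (z, s + t, \<omega>) \<partial>ppr_space Q \<partial>Q) \<partial>lborel)"
proof -
  interpret Q: prob_space Q by fact
  interpret M: prob_space "ppr_space Q" by (rule prob_space_ppr_space) fact
  let ?F = "\<lambda>t. \<integral>\<^sup>+z. \<integral>\<^sup>+\<omega>. Psi (z, t, \<omega>) \<partial>ppr_space Q \<partial>Q"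
  have "(\<integral>\<^sup>+\<omega>. (\<Sum>k. Psi (fst \<omega> !! k, s + ppr_arrival (snd \<omega>) k,
      (sdrop (Suc k) (fst \<omega>), sdrop (Suc k) (snd \<omega>)))) \<partial>ppr_space Q) =
    (\<Sum>k. \<integral>\<^sup>+t. ennreal (erlang_density k 1 t) * ?F (s + t) \<partial>lborel)"
    by (subst nn_integral_suminf) (simp_all only: nn_integral_shifted_arrival[OF Q Psi], measurable)
  also have "\<dots> = (\<integral>\<^sup>+t. (\<Sum>k. ennreal (erlang_density k 1 t) * ?F (s + t)) \<partial>lborel)"
    by (rule nn_integral_suminf[symmetric]) measurable
  also have "\<dots> = (\<integral>\<^sup>+t. indicator {0..} t * ?F (s + t) \<partial>lborel)"
    by (simp only: ennreal_suminf_multc suminf_erlang_density)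
  finally show ?thesis .
qed

section \<open>Campbell's formulas for the marked Poisson process\<close>

lemma nn_integral_suminf_arrival:
  assumes Q: "prob_space Q"
    and phi [measurable]: "phi \<in> borel_measurable (Q \<Otimes>\<^sub>M borel)"
  shows "(\<integral>\<^sup>+\<omega>. (\<Sum>k. phi (fst \<omega> !! k, s + ppr_arrival (snd \<omega>) k)) \<partial>ppr_space Q) =
    (\<integral>\<^sup>+t. indicator {0..} t * (\<integral>\<^sup>+z. phi (z, s + t) \<partial>Q) \<partial>lborel)"
proof -
  interpret M: prob_space "ppr_space Q" by (rule prob_space_ppr_space) fact
  have [measurable]: "(\<lambda>(z, t, \<omega>). phi (z, t)) \<in> borel_measurable (Q \<Otimes>\<^sub>M borel \<Otimes>\<^sub>M ppr_space Q)"
    by measurable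
  show ?thesis
    using nn_integral_suminf_shifted_arrival[OF Q, of "\<lambda>(z, t, \<omega>). phi (z, t)" s]
    by (simp add: M.emeasure_space_1)
qed

text \<open>The time integral is placed inside so that it can be evaluated for a fixed mark, where
  the density is a constant.\<close>

lemma campbell:
  assumes Q: "prob_space Q"
    and phi [measurable]: "phi \<in> borel_measurable (Q \<Otimes>\<^sub>M borel)"
  shows "(\<integral>\<^sup>+\<omega>. (\<Sum>k. phi (fst \<omega> !! k, ppr_arrival (snd \<omega>) k)) \<partial>ppr_space Q) =
    (\<integral>\<^sup>+z. \<integral>\<^sup>+t. indicator {0..} t * phi (z, t) \<partial>lborel \<partial>Q)"
proof -
  interpret Q: prob_space Q by fact
  interpret pair_sigma_finite Q lborel ..
  have "(\<integral>\<^sup>+\<omega>. (\<Sum>k. phi (fst \<omega> !! k, ppr_arrival (snd \<omega>) k)) \<partial>ppr_space Q) =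
    (\<integral>\<^sup>+t. \<integral>\<^sup>+z. indicator {0..} t * phi (z, t) \<partial>Q \<partial>lborel)"
    using nn_integral_suminf_arrival[OF Q phi, of 0] by (simp add: nn_integral_cmult)
  also have "\<dots> = (\<integral>\<^sup>+z. \<integral>\<^sup>+t. indicator {0..} t * phi (z, t) \<partial>lborel \<partial>Q)"
    by (intro Fubini') measurable
  finally show ?thesis .
qed

text \<open>The square splits into the diagonal and twice the pairs of increasing indices. Extending
  the inner sum to an infinite tail makes it a functional of the process after arrival
  \<open>k\<close> alone.\<close>

lemma sum_square_le_tails:
  fixes a :: "nat \<Rightarrow> ennreal"
  shows "(\<Sum>k<n. a k) * (\<Sum>k<n. a k) \<le> (\<Sum>k<n. a k * a k + 2 * (a k * (\<Sum>m. a (Suc k + m))))"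
proof (induction n arbitrary: a)
  case (Suc n)
  let ?s = "\<Sum>k<n. a (Suc k)"
  have "?s \<le> (\<Sum>m. a (Suc 0 + m))"
    using sum_le_suminf[of "\<lambda>m. a (Suc m)" "{..<n}"] by simp
  then have "a 0 * ?s \<le> a 0 * (\<Sum>m. a (Suc 0 + m))"
    by (rule mult_left_mono) simp
  then have "a 0 * a 0 + (a 0 * ?s + a 0 * ?s) + ?s * ?s \<le>
      a 0 * a 0 + (a 0 * (\<Sum>m. a (Suc 0 + m)) + a 0 * (\<Sum>m. a (Suc 0 + m)))
      + (\<Sum>k<n. a (Suc k) * a (Suc k) + 2 * (a (Suc k) * (\<Sum>m. a (Suc (Suc k) + m))))"
    using Suc.IH[of "\<lambda>k. a (Suc k)"] by (intro add_mono order_refl) simp_all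
  then show ?case
    unfolding sum.lessThan_Suc_shift by (simp add: algebra_simps mult_2)
qed simp

lemma suminf_square_le_tails:
  fixes a :: "nat \<Rightarrow> ennreal"
  shows "(\<Sum>k. a k) * (\<Sum>k. a k) \<le> (\<Sum>k. a k * a k) + 2 * (\<Sum>k. a k * (\<Sum>m. a (Suc k + m)))"
proof -
  let ?B = "\<Sum>k. a k * a k + 2 * (a k * (\<Sum>m. a (Suc k + m)))"
  \<comment> \<open>The supremum over partial sums is taken in each factor separately, so the two
    lengths must be independent; both are raised to the larger one.\<close>
  have le: "(\<Sum>k<m. a k) * (\<Sum>k<n. a k) \<le> ?B" for m n
  proof -
    have "(\<Sum>k<m. a k) * (\<Sum>k<n. a k) \<le> (\<Sum>k<max m n. a k) * (\<Sum>k<max m n. a k)"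
      by (intro mult_mono sum_mono2) auto
    also have "\<dots> \<le> (\<Sum>k<max m n. a k * a k + 2 * (a k * (\<Sum>m. a (Suc k + m))))"
      by (rule sum_square_le_tails)
    also have "\<dots> \<le> ?B"
      by (rule sum_le_suminf) auto
    finally show ?thesis .
  qed
  have "(\<Sum>k. a k) * (\<Sum>k. a k) \<le> ?B"
    unfolding suminf_eq_SUP[of a] SUP_mult_left_ennreal SUP_mult_right_ennreal
    by (intro SUP_least) (rule le)
  also have "?B = (\<Sum>k. a k * a k) + 2 * (\<Sum>k. a k * (\<Sum>m. a (Suc k + m)))"
    by (simp add: suminf_add[symmetric])
  finally show ?thesis .
qed

text \<open>The product \<open>a t * a u\<close> is symmetric, so the half plane
  \<open>u \<ge> t\<close> carries half of its integral.\<close>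

lemma nn_integral_triangle:
  fixes a :: "real \<Rightarrow> ennreal"
  assumes [measurable]: "a \<in> borel_measurable borel"
  shows "2 * (\<integral>\<^sup>+t. a t * (\<integral>\<^sup>+u. indicator {t..} u * a u \<partial>lborel) \<partial>lborel) =
    (\<integral>\<^sup>+t. a t \<partial>lborel) * (\<integral>\<^sup>+t. a t \<partial>lborel)"
proof -
  let ?I = "\<integral>\<^sup>+t. a t * (\<integral>\<^sup>+u. indicator {t..} u * a u \<partial>lborel) \<partial>lborel"
  have [measurable]: "Measurable.pred (borel \<Otimes>\<^sub>M borel) (\<lambda>x::real \<times> real. snd x \<in> {fst x..})"
    "Measurable.pred (borel \<Otimes>\<^sub>M borel) (\<lambda>x::real \<times> real. fst x \<in> {snd x..})"
    "Measurable.pred (borel \<Otimes>\<^sub>M borel) (\<lambda>x::real \<times> real. snd x \<in> {fst x<..})"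
    "Measurable.pred (borel \<Otimes>\<^sub>M borel) (\<lambda>x::real \<times> real. snd x \<in> {..fst x})"
    by simp_all
  have [measurable]: "(\<lambda>x::real \<times> real. indicator {fst x..} (snd x) :: ennreal) \<in> borel_measurable (borel \<Otimes>\<^sub>M borel)"
    "(\<lambda>x::real \<times> real. indicator {fst x<..} (snd x) :: ennreal) \<in> borel_measurable (borel \<Otimes>\<^sub>M borel)"
    "(\<lambda>x::real \<times> real. indicator {..fst x} (snd x) :: ennreal) \<in> borel_measurable (borel \<Otimes>\<^sub>M borel)"
    by measurable
  \<comment> \<open>The diagonal is a null set. Dropping it from one copy of \<open>?I\<close> makes
    the two half planes a partition of the plane.\<close>
  have "(\<integral>\<^sup>+u. indicator {t..} u * a u \<partial>lborel) = (\<integral>\<^sup>+u. indicator {t<..} u * a u \<partial>lborel)" for t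
  proof (rule nn_integral_cong_AE)
    show "AE u in lborel. indicator {t..} u * a u = indicator {t<..} u * a u"
      using AE_lborel_singleton[of t] by eventually_elim (auto simp: indicator_def)
  qed
  then have 1: "?I = (\<integral>\<^sup>+t. \<integral>\<^sup>+u. indicator {t<..} u * (a t * a u) \<partial>lborel \<partial>lborel)"
    by (simp add: nn_integral_cmult[symmetric] mult_ac)
  have "?I = (\<integral>\<^sup>+t. \<integral>\<^sup>+u. indicator {t..} u * (a t * a u) \<partial>lborel \<partial>lborel)"
    by (simp add: nn_integral_cmult[symmetric] mult_ac)
  also have "\<dots> = (\<integral>\<^sup>+u. \<integral>\<^sup>+t. indicator {t..} u * (a t * a u) \<partial>lborel \<partial>lborel)"
    by (intro lborel_pair.Fubini') measurable
  also have "\<dots> = (\<integral>\<^sup>+t. \<integral>\<^sup>+u. indicator {..t} u * (a t * a u) \<partial>lborel \<partial>lborel)"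
    by (intro nn_integral_cong) (auto simp: indicator_def mult.commute)
  finally have 2: "?I = (\<integral>\<^sup>+t. \<integral>\<^sup>+u. indicator {..t} u * (a t * a u) \<partial>lborel \<partial>lborel)" .
  have "2 * ?I = ?I + ?I" by (simp add: mult_2)
  also have "\<dots> = (\<integral>\<^sup>+t. \<integral>\<^sup>+u. indicator {t<..} u * (a t * a u) + indicator {..t} u * (a t * a u) \<partial>lborel \<partial>lborel)"
    by (subst 1, subst 2) (simp add: nn_integral_add)
  also have "\<dots> = (\<integral>\<^sup>+t. \<integral>\<^sup>+u. a t * a u \<partial>lborel \<partial>lborel)"
    by (intro nn_integral_cong) (auto simp: indicator_def)
  also have "\<dots> = (\<integral>\<^sup>+t. a t \<partial>lborel) * (\<integral>\<^sup>+t. a t \<partial>lborel)"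
    by (simp add: nn_integral_cmult nn_integral_multc)
  finally show ?thesis .
qed

text \<open>The diagonal terms follow from the first Campbell formula. For the pairs, the process
  after an arrival is a fresh copy, so they contribute the integral of the product of the two
  intensities over a triangle, which doubled is the square of the mean. When the mean is finite, the
  variance is thus at most the integral of the squared \<open>phi\<close>.\<close>

lemma campbell_second_moment:
  assumes Q: "prob_space Q"
    and phi [measurable]: "phi \<in> borel_measurable (Q \<Otimes>\<^sub>M borel)"
  defines "S \<equiv> \<lambda>\<omega>. \<Sum>k. phi (fst \<omega> !! k, ppr_arrival (snd \<omega>) k)"
  shows "(\<integral>\<^sup>+\<omega>. S \<omega> * S \<omega> \<partial>ppr_space Q) \<le>
    (\<integral>\<^sup>+z. \<integral>\<^sup>+t. indicator {0..} t * (phi (z, t) * phi (z, t)) \<partial>lborel \<partial>Q) +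
    (\<integral>\<^sup>+\<omega>. S \<omega> \<partial>ppr_space Q) * (\<integral>\<^sup>+\<omega>. S \<omega> \<partial>ppr_space Q)"
proof -
  interpret Q: prob_space Q by fact
  interpret M: prob_space "ppr_space Q" by (rule prob_space_ppr_space) fact
  \<comment> \<open>The weight of a point times the total weight of all later points, expressed
    through the restarted process \<open>\<omega>\<close>.\<close>
  define Psi where "Psi = (\<lambda>(z, t, \<omega>). phi (z, t) *
    (\<Sum>m. phi (fst \<omega> !! m, t + ppr_arrival (snd \<omega>) m)))"
  have Psi [measurable]: "Psi \<in> borel_measurable (Q \<Otimes>\<^sub>M borel \<Otimes>\<^sub>M ppr_space Q)"
    unfolding Psi_def by measurable
  define m where "m t = (\<integral>\<^sup>+z. phi (z, t) \<partial>Q)" for t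
  have [measurable]: "m \<in> borel_measurable borel"
    unfolding m_def by measurable
  \<comment> \<open>The mean weight per unit of time, cut off before time 0 so that its integral
    over the whole line is the mean of \<open>S\<close>.\<close>
  define a where "a t = indicator {0..} t * m t" for t
  have [measurable]: "a \<in> borel_measurable borel"
    unfolding a_def by measurable
  have "(\<integral>\<^sup>+\<omega>. S \<omega> * S \<omega> \<partial>ppr_space Q) \<le>
    (\<integral>\<^sup>+\<omega>. (\<Sum>k. phi (fst \<omega> !! k, ppr_arrival (snd \<omega>) k) * phi (fst \<omega> !! k, ppr_arrival (snd \<omega>) k)) +
      2 * (\<Sum>k. Psi (fst \<omega> !! k, 0 + ppr_arrival (snd \<omega>) k,
             (sdrop (Suc k) (fst \<omega>), sdrop (Suc k) (snd \<omega>)))) \<partial>ppr_space Q)"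
  proof (rule nn_integral_mono)
    fix \<omega> :: "'a stream \<times> real stream"
    show "S \<omega> * S \<omega> \<le> (\<Sum>k. phi (fst \<omega> !! k, ppr_arrival (snd \<omega>) k) * phi (fst \<omega> !! k, ppr_arrival (snd \<omega>) k)) +
      2 * (\<Sum>k. Psi (fst \<omega> !! k, 0 + ppr_arrival (snd \<omega>) k,
             (sdrop (Suc k) (fst \<omega>), sdrop (Suc k) (snd \<omega>))))"
      using suminf_square_le_tails[of "\<lambda>k. phi (fst \<omega> !! k, ppr_arrival (snd \<omega>) k)"]
      unfolding S_def Psi_def
      by (simp only: ppr_arrival_add sdrop_snth prod.case fst_conv snd_conv add_0)
  qed
  also have "\<dots> = (\<integral>\<^sup>+\<omega>. (\<Sum>k. phi (fst \<omega> !! k, ppr_arrival (snd \<omega>) k) * phi (fst \<omega> !! k, ppr_arrival (snd \<omega>) k)) \<partial>ppr_space Q) +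
      2 * (\<integral>\<^sup>+\<omega>. (\<Sum>k. Psi (fst \<omega> !! k, 0 + ppr_arrival (snd \<omega>) k,
             (sdrop (Suc k) (fst \<omega>), sdrop (Suc k) (snd \<omega>)))) \<partial>ppr_space Q)"
    by (subst nn_integral_add) (measurable, subst nn_integral_cmult, measurable)
  also have "(\<integral>\<^sup>+\<omega>. (\<Sum>k. phi (fst \<omega> !! k, ppr_arrival (snd \<omega>) k) * phi (fst \<omega> !! k, ppr_arrival (snd \<omega>) k)) \<partial>ppr_space Q)
    = (\<integral>\<^sup>+z. \<integral>\<^sup>+t. indicator {0..} t * (phi (z, t) * phi (z, t)) \<partial>lborel \<partial>Q)"
    by (rule campbell[OF Q]) measurable
  also have "(\<integral>\<^sup>+\<omega>. (\<Sum>k. Psi (fst \<omega> !! k, 0 + ppr_arrival (snd \<omega>) k,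
             (sdrop (Suc k) (fst \<omega>), sdrop (Suc k) (snd \<omega>)))) \<partial>ppr_space Q) =
    (\<integral>\<^sup>+t. indicator {0..} t * (\<integral>\<^sup>+z. \<integral>\<^sup>+\<omega>. Psi (z, 0 + t, \<omega>) \<partial>ppr_space Q \<partial>Q) \<partial>lborel)"
    by (rule nn_integral_suminf_shifted_arrival[OF Q Psi])
  also have "\<dots> = (\<integral>\<^sup>+t. a t * (\<integral>\<^sup>+u. indicator {t..} u * a u \<partial>lborel) \<partial>lborel)"
  proof (rule nn_integral_cong)
    fix t :: real
    have "(\<integral>\<^sup>+z. \<integral>\<^sup>+\<omega>. Psi (z, 0 + t, \<omega>) \<partial>ppr_space Q \<partial>Q) =
      (\<integral>\<^sup>+z. phi (z, t) * (\<integral>\<^sup>+\<omega>. (\<Sum>m. phi (fst \<omega> !! m, t + ppr_arrival (snd \<omega>) m)) \<partial>ppr_space Q) \<partial>Q)"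
      unfolding Psi_def by (intro nn_integral_cong) (simp, subst nn_integral_cmult, measurable)
    \<comment> \<open>The expected weight of the later points does not involve the mark
      \<open>z\<close>, so the two factors separate.\<close>
    also have "\<dots> = m t * (\<integral>\<^sup>+u. indicator {0..} u * m (t + u) \<partial>lborel)"
      unfolding nn_integral_suminf_arrival[OF Q phi] m_def by (rule nn_integral_multc) measurable
    also have "(\<integral>\<^sup>+u. indicator {0..} u * m (t + u) \<partial>lborel) = (\<integral>\<^sup>+u. indicator {t..} u * m u \<partial>lborel)"
      by (subst (2) nn_integral_real_affine[where c=1 and t=t]) (auto simp: indicator_def intro!: nn_integral_cong)
    finally have eq: "(\<integral>\<^sup>+z. \<integral>\<^sup>+\<omega>. Psi (z, 0 + t, \<omega>) \<partial>ppr_space Q \<partial>Q) =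
      m t * (\<integral>\<^sup>+u. indicator {t..} u * m u \<partial>lborel)" .
    show "indicator {0..} t * (\<integral>\<^sup>+z. \<integral>\<^sup>+\<omega>. Psi (z, 0 + t, \<omega>) \<partial>ppr_space Q \<partial>Q) =
      a t * (\<integral>\<^sup>+u. indicator {t..} u * a u \<partial>lborel)"
    proof (cases "t \<ge> 0")
      case True
      then have "(\<integral>\<^sup>+u. indicator {t..} u * m u \<partial>lborel) = (\<integral>\<^sup>+u. indicator {t..} u * a u \<partial>lborel)"
        by (intro nn_integral_cong) (auto simp: a_def indicator_def)
      with True show ?thesis unfolding eq by (simp add: a_def)
    qed (simp add: a_def)
  qed
  also have "2 * \<dots> = (\<integral>\<^sup>+t. a t \<partial>lborel) * (\<integral>\<^sup>+t. a t \<partial>lborel)"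
    by (rule nn_integral_triangle) measurable
  also have "(\<integral>\<^sup>+t. a t \<partial>lborel) = (\<integral>\<^sup>+\<omega>. S \<omega> \<partial>ppr_space Q)"
    using nn_integral_suminf_arrival[OF Q phi, of 0] by (simp add: S_def a_def m_def)
  finally show ?thesis .
qed

section \<open>Concentration of the truncated normalising sum\<close>

text \<open>Scaling: \<open>F powr p\<close> against \<open>(theta * F) powr (1 - p)\<close> leaves
  exactly one factor \<open>F\<close>. Averaged over marks, the result sees a density only through
  its total mass. The exponent \<open>p = alpha\<close> serves the mean,
  \<open>p = 2 * alpha\<close> the variance.\<close>

lemma nn_integral_truncated_powr:
  fixes F theta p :: real
  assumes "0 \<le> F" "0 < theta" "1 < p"
  shows "(\<integral>\<^sup>+t. indicator {0..} t * ennreal (if theta * F < t then F powr p / t powr p else 0) \<partial>lborel) =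
    ennreal (theta powr (1 - p) / (p - 1)) * ennreal F"
proof (cases "F = 0")
  case False
  then have F: "0 < F" "0 < theta * F" using assms by auto
  let ?I = "(theta * F) powr (1 - p) / (p - 1)"
  have "((\<lambda>t. t powr (- p)) has_integral ?I) {theta * F..}"
  proof -
    have "?I = - ((theta * F) powr (- p + 1)) / (- p + 1)"
      by (subst minus_divide_divide[symmetric]) simp
    then show ?thesis
      using has_integral_powr_to_inf[of "- p" "theta * F"] assms F by simp
  qed
  then have "((\<lambda>t. if t \<in> {theta * F..} then t powr (- p) else 0) has_integral ?I) UNIV"
    by (subst has_integral_restrict_UNIV)
  then have "(\<integral>\<^sup>+t. ennreal (if t \<in> {theta * F..} then t powr (- p) else 0) \<partial>lborel) = ennreal ?I"
    by (intro nn_integral_has_integral_lborel) auto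
  \<comment> \<open>Strict and weak truncation differ only at the single time
    \<open>theta * F\<close>.\<close>
  moreover have "(\<integral>\<^sup>+t. indicator {0..} t * ennreal (if theta * F < t then F powr p / t powr p else 0) \<partial>lborel) =
      (\<integral>\<^sup>+t. ennreal (F powr p) * ennreal (if t \<in> {theta * F..} then t powr (- p) else 0) \<partial>lborel)"
  proof (rule nn_integral_cong_AE)
    show "AE t in lborel. indicator {0..} t * ennreal (if theta * F < t then F powr p / t powr p else 0) =
        ennreal (F powr p) * ennreal (if t \<in> {theta * F..} then t powr (- p) else 0)"
      using AE_lborel_singleton[of "theta * F"]
      by eventually_elim
        (use F in \<open>auto simp: indicator_def powr_minus divide_inverse ennreal_mult[symmetric]\<close>)
  qed
  ultimately have "(\<integral>\<^sup>+t. indicator {0..} t * ennreal (if theta * F < t then F powr p / t powr p else 0) \<partial>lborel) =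
      ennreal (F powr p * ?I)"
    using assms by (simp add: nn_integral_cmult) (subst ennreal_mult[symmetric], auto)
  also have "F powr p * ?I = theta powr (1 - p) / (p - 1) * (F powr p * F powr (1 - p))"
    using assms F by (simp add: powr_mult)
  also have "F powr p * F powr (1 - p) = F"
    using F by (simp add: powr_add[symmetric])
  also have "ennreal (theta powr (1 - p) / (p - 1) * F) = ennreal (theta powr (1 - p) / (p - 1)) * ennreal F"
    using assms by (intro ennreal_mult) auto
  finally show ?thesis .
next
  case True
  have "indicator {0..} t * ennreal (if theta * F < t then F powr p / t powr p else 0) = 0" for t
    using True by simp
  then show ?thesis using True by (simp only:) simp
qed

text \<open>The cut is at \<open>Ttilde > theta\<close>, that is, at a time proportional to the
  density. It removes the singularity at time 0 and keeps the mean of the sum independent of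
  \<open>f\<close>.\<close>

definition trunc_weight :: "real \<Rightarrow> real \<Rightarrow> ('z \<Rightarrow> real) \<Rightarrow> 'z \<times> real \<Rightarrow> real" where
  "trunc_weight alpha theta f x =
     (if theta * f (fst x) < snd x then f (fst x) powr alpha / snd x powr alpha else 0)"

lemma trunc_weight_nonneg [simp]: "0 \<le> trunc_weight alpha theta f x"
  by (simp add: trunc_weight_def)

lemma measurable_trunc_weight [measurable]:
  assumes [measurable]: "f \<in> borel_measurable Q"
  shows "trunc_weight alpha theta f \<in> borel_measurable (Q \<Otimes>\<^sub>M borel)"
  unfolding trunc_weight_def by measurable

abbreviation trunc_sum :: "real \<Rightarrow> real \<Rightarrow> ('z \<Rightarrow> real) \<Rightarrow> 'z stream \<times> real stream \<Rightarrow> ennreal" where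
  "trunc_sum alpha theta f \<omega> \<equiv>
     (\<Sum>k. ennreal (trunc_weight alpha theta f (fst \<omega> !! k, ppr_arrival (snd \<omega>) k)))"

text \<open>With \<open>h = 1\<close> this is the mean \<open>c\<close> of the truncated sum; with
  \<open>h\<close> the function \<open>excess\<close> it measures the part of \<open>f\<close> that
  violates the pure privacy bound.\<close>

lemma trunc_sum_weighted_mean:
  assumes Q: "prob_space Q"
    and [measurable]: "f \<in> borel_measurable Q" "h \<in> borel_measurable Q"
    and "\<And>z. 0 \<le> f z" "0 < theta" "1 < alpha"
  shows "(\<integral>\<^sup>+\<omega>. (\<Sum>k. h (fst \<omega> !! k) * ennreal (trunc_weight alpha theta f (fst \<omega> !! k, ppr_arrival (snd \<omega>) k))) \<partial>ppr_space Q) =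
    ennreal (theta powr (1 - alpha) / (alpha - 1)) * (\<integral>\<^sup>+z. h z * ennreal (f z) \<partial>Q)"
proof -
  let ?phi = "\<lambda>x. h (fst x) * ennreal (trunc_weight alpha theta f x)"
  have [measurable]: "?phi \<in> borel_measurable (Q \<Otimes>\<^sub>M borel)"
    by measurable
  have "(\<integral>\<^sup>+t. indicator {0..} t * ?phi (z, t) \<partial>lborel) =
      ennreal (theta powr (1 - alpha) / (alpha - 1)) * (h z * ennreal (f z))" for z
  proof -
    have "(\<integral>\<^sup>+t. indicator {0..} t * ?phi (z, t) \<partial>lborel) = h z *
        (\<integral>\<^sup>+t. indicator {0..} t * ennreal (if theta * f z < t then f z powr alpha / t powr alpha else 0) \<partial>lborel)"
      by (subst nn_integral_cmult[symmetric]) (auto simp: trunc_weight_def mult_ac intro!: nn_integral_cong)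
    then show ?thesis
      using assms by (simp only: nn_integral_truncated_powr mult_ac)
  qed
  then show ?thesis
    using campbell[OF Q, of ?phi] by (simp add: nn_integral_cmult)
qed

lemma trunc_sum_mean:
  assumes Q: "prob_space Q"
    and f: "f \<in> borel_measurable Q" "\<And>z. 0 \<le> f z" "(\<integral>\<^sup>+z. ennreal (f z) \<partial>Q) = 1"
    and pos: "0 < theta" "1 < alpha"
  shows "(\<integral>\<^sup>+\<omega>. trunc_sum alpha theta f \<omega> \<partial>ppr_space Q) = ennreal (theta powr (1 - alpha) / (alpha - 1))"
proof -
  have "(\<lambda>_. 1 :: ennreal) \<in> borel_measurable Q" by simp
  from trunc_sum_weighted_mean[OF Q f(1) this f(2) pos] show ?thesis
    by (simp only: mult_1_left f(3) mult_1_right)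
qed

text \<open>A squared truncated weight is a truncated weight with exponent \<open>2 * alpha\<close>,
  so the diagonal term is again explicit and free of \<open>f\<close>.\<close>

lemma trunc_sum_second_moment:
  assumes Q: "prob_space Q"
    and [measurable]: "f \<in> borel_measurable Q"
    and "\<And>z. 0 \<le> f z" "(\<integral>\<^sup>+z. ennreal (f z) \<partial>Q) = 1" "0 < theta" "1 < alpha"
  shows "(\<integral>\<^sup>+\<omega>. trunc_sum alpha theta f \<omega> * trunc_sum alpha theta f \<omega> \<partial>ppr_space Q) \<le>
    ennreal (theta powr (1 - 2 * alpha) / (2 * alpha - 1) + (theta powr (1 - alpha) / (alpha - 1))\<^sup>2)"
proof -
  let ?phi = "\<lambda>x. ennreal (trunc_weight alpha theta f x)"
  have phi [measurable]: "?phi \<in> borel_measurable (Q \<Otimes>\<^sub>M borel)"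
    by measurable
  have "(\<integral>\<^sup>+t. indicator {0..} t * (?phi (z, t) * ?phi (z, t)) \<partial>lborel) =
      ennreal (theta powr (1 - 2 * alpha) / (2 * alpha - 1)) * ennreal (f z)" for z
  proof -
    have "(\<integral>\<^sup>+t. indicator {0..} t * (?phi (z, t) * ?phi (z, t)) \<partial>lborel) =
      (\<integral>\<^sup>+t. indicator {0..} t * ennreal (if theta * f z < t then f z powr (2 * alpha) / t powr (2 * alpha) else 0) \<partial>lborel)"
      by (intro nn_integral_cong)
        (auto simp: trunc_weight_def ennreal_mult[symmetric] powr_add[symmetric])
    then show ?thesis
      using assms by (simp only: nn_integral_truncated_powr)
  qed
  then have diag: "(\<integral>\<^sup>+z. \<integral>\<^sup>+t. indicator {0..} t * (?phi (z, t) * ?phi (z, t)) \<partial>lborel \<partial>Q) =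
      ennreal (theta powr (1 - 2 * alpha) / (2 * alpha - 1))"
    using assms by (simp add: nn_integral_cmult)
  have mean: "(\<integral>\<^sup>+\<omega>. trunc_sum alpha theta f \<omega> \<partial>ppr_space Q) = ennreal (theta powr (1 - alpha) / (alpha - 1))"
    by (rule trunc_sum_mean) fact+
  have sq: "ennreal (theta powr (1 - 2 * alpha) / (2 * alpha - 1) + (theta powr (1 - alpha) / (alpha - 1))\<^sup>2) =
      ennreal (theta powr (1 - 2 * alpha) / (2 * alpha - 1)) +
      ennreal (theta powr (1 - alpha) / (alpha - 1)) * ennreal (theta powr (1 - alpha) / (alpha - 1))"
  proof -
    have sq: "ennreal (v + c\<^sup>2) = ennreal v + ennreal c * ennreal c" if "0 \<le> v" "0 \<le> c" for v c :: real
      using that by (simp add: power2_eq_square ennreal_mult)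
    show ?thesis by (rule sq) (use assms in auto)
  qed
  show ?thesis
    using campbell_second_moment[OF Q phi] by (simp only: diag mean sq)
qed

text \<open>The moment bound says that the variance is at most \<open>v\<close>. The value infinity
  is listed separately because \<open>enn2real\<close> sends it to 0; it has probability zero since
  the mean is finite.\<close>

lemma Chebyshev_nn_integral:
  fixes S :: "'a \<Rightarrow> ennreal"
  assumes "prob_space M" and [measurable]: "S \<in> borel_measurable M"
    and mean: "(\<integral>\<^sup>+x. S x \<partial>M) = ennreal c"
    and second: "(\<integral>\<^sup>+x. S x * S x \<partial>M) \<le> ennreal (v + c\<^sup>2)"
    and "0 \<le> c" "0 \<le> v" "0 < a"
  shows "emeasure M {x \<in> space M. S x = \<infinity> \<or> a \<le> \<bar>enn2real (S x) - c\<bar>} \<le> ennreal (v / a\<^sup>2)"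
proof -
  interpret prob_space M by fact
  define X where "X x = enn2real (S x)" for x
  have [measurable]: "X \<in> borel_measurable M"
    unfolding X_def by measurable
  have fin: "AE x in M. S x < \<infinity>"
    using nn_integral_PInf_AE[of S M] mean by (auto simp: less_top)
  have "(\<integral>\<^sup>+x. ennreal (X x) \<partial>M) = (\<integral>\<^sup>+x. S x \<partial>M)"
    using fin by (intro nn_integral_cong_AE) (auto simp: X_def)
  then have "has_bochner_integral M X c"
    using mean \<open>0 \<le> c\<close> by (intro has_bochner_integral_nn_integral) (auto simp: X_def)
  then have X: "integrable M X" "expectation X = c"
    by (auto simp: has_bochner_integral_iff)
  have "(\<integral>\<^sup>+x. ennreal ((X x)\<^sup>2) \<partial>M) = (\<integral>\<^sup>+x. S x * S x \<partial>M)"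
    using fin by (intro nn_integral_cong_AE)
      (auto simp: X_def power2_eq_square ennreal_mult)
  then have le: "(\<integral>\<^sup>+x. ennreal ((X x)\<^sup>2) \<partial>M) \<le> ennreal (v + c\<^sup>2)"
    using second by simp
  then have X2: "integrable M (\<lambda>x. (X x)\<^sup>2)"
    by (intro integrableI_nonneg) (auto simp: le_less_trans)
  then have "expectation (\<lambda>x. (X x)\<^sup>2) \<le> v + c\<^sup>2"
    using le \<open>0 \<le> v\<close> by (simp add: nn_integral_eq_integral del: ennreal_plus)
  then have "variance X \<le> v"
    using variance_eq[OF X(1) X2] X(2) by simp
  then have "variance X / a\<^sup>2 \<le> v / a\<^sup>2"
    by (rule divide_right_mono) simp
  moreover have "prob {x \<in> space M. a \<le> \<bar>X x - c\<bar>} \<le> variance X / a\<^sup>2"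
    using Chebyshev_inequality[OF _ X2 \<open>0 < a\<close>] X(2) by simp
  ultimately have "prob {x \<in> space M. a \<le> \<bar>X x - c\<bar>} \<le> v / a\<^sup>2"
    by (rule order_trans[rotated])
  then have "emeasure M {x \<in> space M. a \<le> \<bar>X x - c\<bar>} \<le> ennreal (v / a\<^sup>2)"
    by (simp add: emeasure_eq_measure ennreal_leI)
  also have "emeasure M {x \<in> space M. a \<le> \<bar>X x - c\<bar>} =
      emeasure M {x \<in> space M. S x = \<infinity> \<or> a \<le> \<bar>enn2real (S x) - c\<bar>}"
    using fin by (intro emeasure_eq_AE) (auto simp: X_def)
  finally show ?thesis .
qed

text \<open>Requiring \<open>theta * f z < T k\<close> for all \<open>k\<close> also excludes the null event of a nonpositive arrival time.\<close>

definition bad_event :: "real \<Rightarrow> real \<Rightarrow> real \<Rightarrow> ('z \<Rightarrow> real) \<Rightarrow> 'z stream \<times> real stream \<Rightarrow> bool" where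
  "bad_event alpha theta eta f \<omega> \<longleftrightarrow>
     (\<exists>k. ppr_arrival (snd \<omega>) k \<le> theta * f (fst \<omega> !! k)) \<or>
     trunc_sum alpha theta f \<omega> = \<infinity> \<or>
     eta * (theta powr (1 - alpha) / (alpha - 1)) \<le>
       \<bar>enn2real (trunc_sum alpha theta f \<omega>) - theta powr (1 - alpha) / (alpha - 1)\<bar>"

lemma measurable_bad_event [measurable]:
  assumes [measurable]: "f \<in> borel_measurable Q"
  shows "Measurable.pred (ppr_space Q) (bad_event alpha theta eta f)"
proof -
  have "(\<lambda>\<omega>. trunc_weight alpha theta f (fst \<omega> !! k, ppr_arrival (snd \<omega>) k)) \<in> borel_measurable (ppr_space Q)" for k
    by measurable
  then have [measurable]: "(\<lambda>\<omega>. trunc_sum alpha theta f \<omega>) \<in> borel_measurable (ppr_space Q)"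
    by (intro borel_measurable_suminf_order measurable_compose[OF _ measurable_ennreal])
  show ?thesis
    unfolding bad_event_def by simp
qed

text \<open>First-moment bound: the expected number of points with
  \<open>T k \<le> theta * f (Z k)\<close> is \<open>theta\<close> times the integral of
  \<open>f\<close>.\<close>

lemma emeasure_early_arrival_le:
  assumes Q: "prob_space Q" and [measurable]: "f \<in> borel_measurable Q"
    and f: "\<And>z. 0 \<le> f z" "(\<integral>\<^sup>+z. ennreal (f z) \<partial>Q) = 1" and "0 < theta"
  shows "emeasure (ppr_space Q)
    {\<omega> \<in> space (ppr_space Q). \<exists>k. ppr_arrival (snd \<omega>) k \<le> theta * f (fst \<omega> !! k)} \<le> ennreal theta"
proof -
  let ?phi = "\<lambda>x. indicator {..theta * f (fst x)} (snd x) :: ennreal"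
  have [measurable]: "Measurable.pred (Q \<Otimes>\<^sub>M borel) (\<lambda>x. snd x \<in> {..theta * f (fst x)})"
    by simp
  have phi [measurable]: "?phi \<in> borel_measurable (Q \<Otimes>\<^sub>M borel)"
    by measurable
  let ?A = "{\<omega> \<in> space (ppr_space Q). \<exists>k. ppr_arrival (snd \<omega>) k \<le> theta * f (fst \<omega> !! k)}"
  have "emeasure (ppr_space Q) ?A = (\<integral>\<^sup>+\<omega>. indicator ?A \<omega> \<partial>ppr_space Q)"
    by (rule nn_integral_indicator[symmetric]) measurable
  also have "\<dots> \<le> (\<integral>\<^sup>+\<omega>. (\<Sum>k. ?phi (fst \<omega> !! k, ppr_arrival (snd \<omega>) k)) \<partial>ppr_space Q)"
  proof (rule nn_integral_mono)
    fix \<omega> :: "'a stream \<times> real stream"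
    show "indicator ?A \<omega> \<le> (\<Sum>k. ?phi (fst \<omega> !! k, ppr_arrival (snd \<omega>) k))"
    proof (cases "\<omega> \<in> ?A")
      case True
      then obtain k where "?phi (fst \<omega> !! k, ppr_arrival (snd \<omega>) k) = 1"
        by (auto simp: indicator_def)
      then show ?thesis
        using True sum_le_suminf[of "\<lambda>k. ?phi (fst \<omega> !! k, ppr_arrival (snd \<omega>) k)" "{k}"] by simp
    qed simp
  qed
  also have "\<dots> = (\<integral>\<^sup>+z. \<integral>\<^sup>+t. indicator {0..} t * ?phi (z, t) \<partial>lborel \<partial>Q)"
    by (rule campbell[OF Q phi])
  also have "\<dots> = (\<integral>\<^sup>+z. ennreal theta * ennreal (f z) \<partial>Q)"
  proof (rule nn_integral_cong)
    fix z
    have "(\<integral>\<^sup>+t. indicator {0..} t * ?phi (z, t) \<partial>lborel) = (\<integral>\<^sup>+t. indicator {0..theta * f z} t \<partial>lborel)"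
      by (intro nn_integral_cong) (auto simp: indicator_def)
    then show "(\<integral>\<^sup>+t. indicator {0..} t * ?phi (z, t) \<partial>lborel) = ennreal theta * ennreal (f z)"
      using f(1)[of z] \<open>0 < theta\<close> by (simp add: ennreal_mult)
  qed
  also have "\<dots> = ennreal theta"
    using f(2) by (simp add: nn_integral_cmult)
  finally show ?thesis .
qed

text \<open>A union bound: early arrivals cost \<open>theta\<close>, and Chebyshev's inequality at
  distance \<open>eta * c\<close> gives the other term.\<close>

lemma emeasure_bad_event_le:
  assumes Q: "prob_space Q" and [measurable]: "f \<in> borel_measurable Q"
    and f: "\<And>z. 0 \<le> f z" "(\<integral>\<^sup>+z. ennreal (f z) \<partial>Q) = 1"
    and pos: "0 < theta" "1 < alpha" "0 < eta"
  shows "emeasure (ppr_space Q) {\<omega> \<in> space (ppr_space Q). bad_event alpha theta eta f \<omega>}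
    \<le> ennreal (theta + (alpha - 1)\<^sup>2 / (theta * eta\<^sup>2))"
proof -
  let ?c = "theta powr (1 - alpha) / (alpha - 1)"
  let ?v = "theta powr (1 - 2 * alpha) / (2 * alpha - 1)"
  let ?A = "{\<omega> \<in> space (ppr_space Q). \<exists>k. ppr_arrival (snd \<omega>) k \<le> theta * f (fst \<omega> !! k)}"
  let ?B = "{\<omega> \<in> space (ppr_space Q). trunc_sum alpha theta f \<omega> = \<infinity> \<or>
     eta * ?c \<le> \<bar>enn2real (trunc_sum alpha theta f \<omega>) - ?c\<bar>}"
  have "{\<omega> \<in> space (ppr_space Q). bad_event alpha theta eta f \<omega>} = ?A \<union> ?B"
    unfolding bad_event_def by auto
  then have "emeasure (ppr_space Q) {\<omega> \<in> space (ppr_space Q). bad_event alpha theta eta f \<omega>}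
    \<le> emeasure (ppr_space Q) ?A + emeasure (ppr_space Q) ?B"
    by (simp only:) (rule emeasure_subadditive, measurable)
  also have "\<dots> \<le> ennreal theta + ennreal (?v / (eta * ?c)\<^sup>2)"
  proof (rule add_mono)
    show "emeasure (ppr_space Q) ?A \<le> ennreal theta"
      by (rule emeasure_early_arrival_le) fact+
    show "emeasure (ppr_space Q) ?B \<le> ennreal (?v / (eta * ?c)\<^sup>2)"
    proof (rule Chebyshev_nn_integral)
      show "(\<integral>\<^sup>+\<omega>. trunc_sum alpha theta f \<omega> \<partial>ppr_space Q) = ennreal ?c"
        by (rule trunc_sum_mean) fact+
      show "(\<integral>\<^sup>+\<omega>. trunc_sum alpha theta f \<omega> * trunc_sum alpha theta f \<omega> \<partial>ppr_space Q) \<le> ennreal (?v + ?c\<^sup>2)"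
        by (rule trunc_sum_second_moment) fact+
      show "prob_space (ppr_space Q)"
        by (rule prob_space_ppr_space) fact
      show "0 \<le> ?c" "0 \<le> ?v" "0 < eta * ?c"
        using pos by simp_all
    qed measurable
  qed
  also have "\<dots> \<le> ennreal (theta + (alpha - 1)\<^sup>2 / (theta * eta\<^sup>2))"
  proof -
    \<comment> \<open>The variance bound contains the square of
      \<open>theta powr (1 - alpha)\<close>, which cancels against the square of \<open>c\<close>
      and leaves \<open>1 / theta\<close>. The remaining divisor \<open>2 * alpha - 1\<close>
      exceeds 1.\<close>
    have "theta powr (1 - 2 * alpha) = theta powr (1 - alpha) * theta powr (1 - alpha) / theta"
    proof -
      have "theta powr (1 - 2 * alpha) = theta powr ((1 - alpha) + (1 - alpha) - 1)"
        by simp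
      then show ?thesis
        unfolding powr_diff[of _ _ 1] powr_add using pos by simp
    qed
    moreover have "A * A / theta / d / (eta * (A / b))\<^sup>2 = b\<^sup>2 / (theta * eta\<^sup>2) / d"
      if "0 < A" "0 < b" "0 < d" for A b d :: real
      using that pos by (simp add: field_simps power2_eq_square)
    ultimately have "?v / (eta * ?c)\<^sup>2 = (alpha - 1)\<^sup>2 / (theta * eta\<^sup>2) / (2 * alpha - 1)"
      using pos by simp
    also have "\<dots> \<le> (alpha - 1)\<^sup>2 / (theta * eta\<^sup>2) / 1"
      using pos by (intro divide_left_mono) auto
    finally have "theta + ?v / (eta * ?c)\<^sup>2 \<le> theta + (alpha - 1)\<^sup>2 / (theta * eta\<^sup>2)"
      by simp
    moreover have "ennreal theta + ennreal (?v / (eta * ?c)\<^sup>2) = ennreal (theta + ?v / (eta * ?c)\<^sup>2)"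
      using pos by (intro ennreal_plus[symmetric]) auto
    ultimately show ?thesis
      by (simp only: ennreal_leI)
  qed
  finally show ?thesis .
qed

section \<open>The output law of the mechanism\<close>

definition point_weight :: "real \<Rightarrow> ('z \<Rightarrow> real) \<Rightarrow> 'z stream \<times> real stream \<Rightarrow> nat \<Rightarrow> real" where
  "point_weight alpha f \<omega> k = f (fst \<omega> !! k) powr alpha / ppr_arrival (snd \<omega>) k powr alpha"

text \<open>The conditional probability, given the points, that the output lies in \<open>X\<close>.
  The last branch mirrors the default index 0 of \<open>ppr_K_dist\<close>.\<close>

definition selection_prob ::
  "real \<Rightarrow> ('z \<Rightarrow> real) \<Rightarrow> ('z stream \<times> nat) set \<Rightarrow> 'z stream \<times> real stream \<Rightarrow> ennreal" where
  "selection_prob alpha f X \<omega> =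
     (let s = (\<Sum>k. ennreal (point_weight alpha f \<omega> k))
      in if 0 < s \<and> s < \<infinity>
         then (\<Sum>k. ennreal (point_weight alpha f \<omega> k) / s * indicator X (fst \<omega>, k))
         else indicator X (fst \<omega>, 0))"

lemma point_weight_nonneg [simp]: "0 \<le> point_weight alpha f \<omega> k"
  by (simp add: point_weight_def)

lemma measurable_point_weight [measurable]:
  assumes [measurable]: "f \<in> borel_measurable Q"
  shows "(\<lambda>\<omega>. point_weight alpha f \<omega> k) \<in> borel_measurable (ppr_space Q)"
  unfolding point_weight_def by measurable

lemma measurable_selection_prob [measurable]:
  assumes [measurable]: "f \<in> borel_measurable Q" "X \<in> sets (stream_space Q \<Otimes>\<^sub>M count_space UNIV)"
  shows "selection_prob alpha f X \<in> borel_measurable (ppr_space Q)"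
proof -
  have [measurable]: "(\<lambda>\<omega>. \<Sum>k. ennreal (point_weight alpha f \<omega> k)) \<in> borel_measurable (ppr_space Q)"
    by (intro borel_measurable_suminf_order measurable_compose[OF measurable_point_weight measurable_ennreal]) fact
  have [measurable]: "(\<lambda>\<omega>. indicator X (fst \<omega>, k) :: ennreal) \<in> borel_measurable (ppr_space Q)" for k
    by measurable
  show ?thesis
    unfolding selection_prob_def[abs_def] Let_def by measurable
qed

lemma selection_prob_UNIV: "selection_prob alpha f UNIV \<omega> = 1"
proof -
  define w where "w k = ennreal (point_weight alpha f \<omega> k)" for k
  define s where "s = (\<Sum>k. w k)"
  have "(\<Sum>k. w k / s * indicator UNIV (fst \<omega>, k)) = s / s"
    unfolding divide_ennreal_def by (simp add: s_def ennreal_suminf_multc)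
  moreover have "s / s = 1" if "0 < s" "s < \<infinity>"
    using that by (auto simp: ennreal_divide_self)
  ultimately show ?thesis
    unfolding selection_prob_def Let_def w_def[symmetric] s_def[symmetric] by (auto simp: less_top)
qed

lemma selection_prob_le_1: "selection_prob alpha f X \<omega> \<le> 1"
proof -
  have "selection_prob alpha f X \<omega> \<le> selection_prob alpha f UNIV \<omega>"
  proof -
    have "(\<Sum>k. w k * indicator X (fst \<omega>, k)) \<le> (\<Sum>k. w k * indicator UNIV (fst \<omega>, k))"
      for w :: "nat \<Rightarrow> ennreal"
      by (intro suminf_le mult_left_mono) (auto simp: indicator_def)
    moreover have "indicator X (fst \<omega>, 0::nat) \<le> (indicator UNIV (fst \<omega>, 0) :: ennreal)"
      by (auto simp: indicator_def)
    ultimately show ?thesis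
      unfolding selection_prob_def Let_def by (auto simp only: split: if_split)
  qed
  then show ?thesis by (simp add: selection_prob_UNIV)
qed

lemma emeasure_ppr_K_dist:
  "emeasure (ppr_K_dist Q P alpha (fst \<omega>) (snd \<omega>)) {k. (fst \<omega>, k) \<in> X} =
    selection_prob alpha (\<lambda>z. enn2real (RN_deriv Q P z)) X \<omega>"
proof -
  have "ppr_weight Q P alpha (fst \<omega>) (snd \<omega>) = point_weight alpha (\<lambda>z. enn2real (RN_deriv Q P z)) \<omega>"
    by (simp add: fun_eq_iff ppr_weight_def point_weight_def)
  moreover have "indicator {k. (fst \<omega>, k) \<in> X} k = (indicator X (fst \<omega>, k) :: ennreal)" for k
    by (simp add: indicator_def)
  ultimately show ?thesis
    by (auto simp: ppr_K_dist_def selection_prob_def Let_def emeasure_density nn_integral_count_space_nat)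
qed

lemma sets_ppr_K_dist [simp]: "sets (ppr_K_dist Q P alpha zs es) = UNIV"
  by (simp add: ppr_K_dist_def Let_def)

lemma emeasure_distr_ppr_K_dist:
  assumes "\<omega> \<in> space (ppr_space Q)" and X: "X \<in> sets (stream_space Q \<Otimes>\<^sub>M count_space UNIV)"
  shows "emeasure (distr (ppr_K_dist Q P alpha (fst \<omega>) (snd \<omega>))
      (stream_space Q \<Otimes>\<^sub>M count_space UNIV) (\<lambda>k. (fst \<omega>, k))) X =
    selection_prob alpha (\<lambda>z. enn2real (RN_deriv Q P z)) X \<omega>"
proof -
  have space: "space (ppr_K_dist Q P alpha (fst \<omega>) (snd \<omega>)) = UNIV"
    using sets_eq_imp_space_eq[of "ppr_K_dist Q P alpha (fst \<omega>) (snd \<omega>)" "count_space UNIV"] by simp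
  have "fst \<omega> \<in> space (stream_space Q)"
    using assms by (auto simp: space_pair_measure)
  then have "(\<lambda>k. (fst \<omega>, k)) \<in> ppr_K_dist Q P alpha (fst \<omega>) (snd \<omega>) \<rightarrow>\<^sub>M stream_space Q \<Otimes>\<^sub>M count_space UNIV"
    by (auto simp: measurable_def space space_pair_measure)
  then show ?thesis
    using X by (simp add: emeasure_distr space vimage_def emeasure_ppr_K_dist)
qed

lemma
  assumes Q: "prob_space Q"
  shows sets_ppr_mech: "sets (ppr_mech Q PZX alpha x) = sets (stream_space Q \<Otimes>\<^sub>M count_space UNIV)"
    and emeasure_ppr_mech: "X \<in> sets (stream_space Q \<Otimes>\<^sub>M count_space UNIV) \<Longrightarrow>
      emeasure (ppr_mech Q PZX alpha x) X =
      (\<integral>\<^sup>+\<omega>. selection_prob alpha (\<lambda>z. enn2real (RN_deriv Q (PZX x) z)) X \<omega> \<partial>ppr_space Q)"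
proof -
  interpret M: prob_space "ppr_space Q" by (rule prob_space_ppr_space) fact
  let ?N = "stream_space Q \<Otimes>\<^sub>M count_space (UNIV :: nat set)"
  let ?K = "\<lambda>\<omega>. distr (ppr_K_dist Q (PZX x) alpha (fst \<omega>) (snd \<omega>)) ?N (\<lambda>k. (fst \<omega>, k))"
  let ?f = "\<lambda>z. enn2real (RN_deriv Q (PZX x) z)"
  \<comment> \<open>Measurability of the kernel reduces to measurability of
    \<open>selection_prob\<close> for each fixed output set; it is what turns the bind into an
    integral.\<close>
  have K: "?K \<in> ppr_space Q \<rightarrow>\<^sub>M subprob_algebra ?N"
  proof (rule measurable_subprob_algebra)
    fix X assume X [measurable]: "X \<in> sets ?N"
    have "selection_prob alpha ?f X \<in> borel_measurable (ppr_space Q)"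
      by measurable
    then show "(\<lambda>\<omega>. emeasure (?K \<omega>) X) \<in> borel_measurable (ppr_space Q)"
      using X by (subst measurable_cong[OF emeasure_distr_ppr_K_dist])
  next
    fix \<omega> assume \<omega>: "\<omega> \<in> space (ppr_space Q)"
    show "subprob_space (?K \<omega>)"
    proof
      show "emeasure (?K \<omega>) (space (?K \<omega>)) \<le> 1"
        using emeasure_distr_ppr_K_dist[OF \<omega> sets.top] selection_prob_le_1 by simp
      show "space (?K \<omega>) \<noteq> {}"
        using \<omega> by (auto simp: space_pair_measure)
    qed
  qed simp
  have mech: "ppr_mech Q PZX alpha x = ppr_space Q \<bind> ?K"
    by (simp add: ppr_mech_def case_prod_beta')
  show "sets (ppr_mech Q PZX alpha x) = sets ?N"
    unfolding mech by (rule sets_bind_measurable[OF K M.not_empty])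
  show "emeasure (ppr_mech Q PZX alpha x) X = (\<integral>\<^sup>+\<omega>. selection_prob alpha ?f X \<omega> \<partial>ppr_space Q)"
    if X: "X \<in> sets ?N"
    unfolding mech emeasure_bind[OF M.not_empty K X]
    by (intro nn_integral_cong emeasure_distr_ppr_K_dist X)
qed

section \<open>Real-valued densities and the privacy hypothesis\<close>

text \<open>The derivative is finite almost everywhere, so sending infinity to 0 changes it on a
  null set only.\<close>

lemma density_enn2real_RN_deriv:
  assumes "prob_space Q" "prob_space P" "sets P = sets Q" "absolutely_continuous Q P"
  shows "density Q (\<lambda>z. ennreal (enn2real (RN_deriv Q P z))) = P"
proof -
  interpret Q: prob_space Q by fact
  interpret P: prob_space P by fact
  have "AE z in Q. RN_deriv Q P z \<noteq> \<infinity>"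
    using assms by (intro Q.RN_deriv_finite P.sigma_finite_measure) auto
  then have "density Q (\<lambda>z. ennreal (enn2real (RN_deriv Q P z))) = density Q (RN_deriv Q P)"
    by (intro density_cong) (auto simp: less_top)
  also have "\<dots> = P"
    using assms by (intro Q.density_RN_deriv)
  finally show ?thesis .
qed

text \<open>For \<open>r > 0\<close>, combine \<open>1 - 1 / r \<le> ln r\<close> with
  \<open>1 + x \<le> exp x\<close> at \<open>x = (a - 1) * ln r\<close>, then multiply by
  \<open>r\<close>.\<close>

lemma Bernoulli_inequality_powr:
  fixes r a :: real
  assumes "0 \<le> r" "1 \<le> a"
  shows "1 - r powr a \<le> a * (1 - r)"
proof (cases "r = 0")
  case False
  then have r: "0 < r" using assms by simp
  have "1 - 1 / r \<le> ln r"
    using ln_le_minus_one[of "1 / r"] r by (simp add: ln_div)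
  then have "(a - 1) * (1 - 1 / r) \<le> (a - 1) * ln r"
    using assms by (intro mult_left_mono) auto
  also have "\<dots> \<le> r powr (a - 1) - 1"
    using exp_ge_add_one_self[of "(a - 1) * ln r"] r by (simp add: powr_def algebra_simps)
  finally have "r * ((a - 1) * (1 - 1 / r)) \<le> r * (r powr (a - 1) - 1)"
    using r by (intro mult_left_mono) auto
  moreover have "r * r powr (a - 1) = r powr a"
    using r by (simp add: powr_diff)
  moreover have "r * ((a - 1) * (1 - 1 / r)) = (a - 1) * (r - 1)"
    using r by (simp add: field_simps)
  ultimately show ?thesis
    by (simp add: algebra_simps)
qed (use assms in simp)

text \<open>The integral is the privacy gap of the set \<open>A\<close> where \<open>f\<close>
  exceeds \<open>exp eps * g\<close>, so the hypothesis at this one set bounds it.\<close>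

lemma nn_integral_hockey_stick_le:
  fixes f g :: "'z \<Rightarrow> real" and eps delta :: real
  assumes [measurable]: "f \<in> borel_measurable Q" "g \<in> borel_measurable Q"
    and "\<And>z. 0 \<le> g z"
    and fin: "finite_measure (density Q (\<lambda>z. ennreal (f z)))" "finite_measure (density Q (\<lambda>z. ennreal (g z)))"
    and dp: "\<And>A. A \<in> sets Q \<Longrightarrow>
      measure (density Q (\<lambda>z. ennreal (f z))) A \<le> exp eps * measure (density Q (\<lambda>z. ennreal (g z))) A + delta"
  shows "(\<integral>\<^sup>+z. ennreal (max 0 (f z - exp eps * g z)) \<partial>Q) \<le> ennreal delta"
proof -
  define A where "A = {z \<in> space Q. exp eps * g z < f z}"
  have A [measurable]: "A \<in> sets Q" unfolding A_def by measurable
  let ?P = "density Q (\<lambda>z. ennreal (f z))" and ?P' = "density Q (\<lambda>z. ennreal (g z))"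
  interpret P: finite_measure ?P by fact
  interpret P': finite_measure ?P' by fact
  have delta: "0 \<le> delta" using dp[of "{}"] by simp
  \<comment> \<open>Subtraction of extended reals is avoided by adding the finite term
    \<open>exp eps * P'(A)\<close> to both sides and cancelling it at the end.\<close>
  have "ennreal (exp eps) * emeasure ?P' A + (\<integral>\<^sup>+z. ennreal (max 0 (f z - exp eps * g z)) \<partial>Q) =
      (\<integral>\<^sup>+z. ennreal (exp eps) * (ennreal (g z) * indicator A z) + ennreal (max 0 (f z - exp eps * g z)) \<partial>Q)"
    by (simp add: emeasure_density nn_integral_cmult nn_integral_add)
  also have "\<dots> = (\<integral>\<^sup>+z. ennreal (f z) * indicator A z \<partial>Q)"
    using assms(3) by (intro nn_integral_cong)
      (auto simp: A_def indicator_def max_def ennreal_mult[symmetric] ennreal_plus[symmetric] simp del: ennreal_plus)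
  also have "\<dots> = emeasure ?P A"
    by (simp add: emeasure_density)
  also have "\<dots> \<le> ennreal (exp eps * measure ?P' A + delta)"
    unfolding P.emeasure_eq_measure by (intro ennreal_leI dp A)
  also have "\<dots> = ennreal (exp eps) * emeasure ?P' A + ennreal delta"
    using delta by (simp add: P'.emeasure_eq_measure ennreal_mult)
  finally have "ennreal (exp eps) * emeasure ?P' A = \<infinity> \<or>
      (\<integral>\<^sup>+z. ennreal (max 0 (f z - exp eps * g z)) \<partial>Q) \<le> ennreal delta"
    by (subst (asm) ennreal_add_left_cancel_le)
  then show ?thesis
    by (simp add: P'.emeasure_eq_measure ennreal_mult_eq_top_iff)
qed

section \<open>Comparison of neighbouring inputs\<close>

text \<open>Outside the bad event no point is truncated, so the true normalising sum is the
  truncated one. It lies within \<open>eta * c\<close> of \<open>c\<close>, hence is positive and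
  finite, and the default branch is excluded.\<close>

lemma selection_prob_good_event:
  assumes good: "\<not> bad_event alpha theta eta f \<omega>" and "\<And>z. 0 \<le> f z" "0 < theta" "1 < alpha" "0 < eta" "eta < 1"
  defines "c \<equiv> theta powr (1 - alpha) / (alpha - 1)"
  obtains s where "(1 - eta) * c < s" "s < (1 + eta) * c" "0 < s"
    "\<And>k. trunc_weight alpha theta f (fst \<omega> !! k, ppr_arrival (snd \<omega>) k) = point_weight alpha f \<omega> k"
    "\<And>X. selection_prob alpha f X \<omega> = (\<Sum>k. ennreal (point_weight alpha f \<omega> k / s) * indicator X (fst \<omega>, k))"
proof -
  have eq: "trunc_weight alpha theta f (fst \<omega> !! k, ppr_arrival (snd \<omega>) k) = point_weight alpha f \<omega> k" for k
    using good by (auto simp: bad_event_def trunc_weight_def point_weight_def not_le)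
  define s where "s = enn2real (trunc_sum alpha theta f \<omega>)"
  have c: "0 < c" using assms by (simp add: c_def)
  have "\<bar>s - c\<bar> < eta * c"
    using good unfolding bad_event_def c_def s_def by linarith
  then have s: "(1 - eta) * c < s" "s < (1 + eta) * c"
    by (auto simp: algebra_simps)
  moreover have "0 < (1 - eta) * c" using c assms by simp
  ultimately have pos: "0 < s" by linarith
  have "trunc_sum alpha theta f \<omega> < \<infinity>"
    using good unfolding bad_event_def by (simp add: less_top)
  then have "trunc_sum alpha theta f \<omega> = ennreal s"
    unfolding s_def by simp
  then have sum: "(\<Sum>k. ennreal (point_weight alpha f \<omega> k)) = ennreal s"
    unfolding eq .
  have "selection_prob alpha f X \<omega> = (\<Sum>k. ennreal (point_weight alpha f \<omega> k / s) * indicator X (fst \<omega>, k))" for X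
    unfolding selection_prob_def Let_def sum using pos by (simp add: divide_ennreal)
  with s pos eq show ?thesis by (rule that)
qed

text \<open>An upper bound for \<open>1 - (min (f z) (exp eps * g z) / f z) powr alpha\<close>, chosen so that multiplying it
  by \<open>f z\<close> gives \<open>alpha\<close> times the hockey-stick integrand.\<close>

definition excess :: "real \<Rightarrow> real \<Rightarrow> ('z \<Rightarrow> real) \<Rightarrow> ('z \<Rightarrow> real) \<Rightarrow> 'z \<Rightarrow> real" where
  "excess alpha eps f g z = (if f z \<le> exp eps * g z then 0 else alpha * (1 - exp eps * g z / f z))"

lemma measurable_excess [measurable]:
  assumes [measurable]: "f \<in> borel_measurable Q" "g \<in> borel_measurable Q"
  shows "excess alpha eps f g \<in> borel_measurable Q"
  unfolding excess_def by measurable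

lemma excess_nonneg:
  assumes "0 \<le> g z" "0 \<le> alpha"
  shows "0 \<le> excess alpha eps f g z"
proof (cases "f z \<le> exp eps * g z")
  case False
  moreover have "0 \<le> exp eps * g z" using assms by simp
  ultimately have "0 < f z" "exp eps * g z < f z" by linarith+
  then show ?thesis using assms by (simp add: excess_def)
qed (simp add: excess_def)

lemma excess_mult:
  assumes "0 \<le> g z"
  shows "excess alpha eps f g z * f z = alpha * max 0 (f z - exp eps * g z)"
proof (cases "f z \<le> exp eps * g z")
  case False
  moreover have "0 \<le> exp eps * g z" using assms by simp
  ultimately have "0 < f z" "exp eps * g z < f z" by linarith+
  then show ?thesis by (simp add: excess_def max_def field_simps)
qed (simp add: excess_def)

text \<open>If \<open>f z \<le> exp eps * g z\<close>, monotonicity suffices. Otherwise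
  \<open>r = exp eps * g z / f z\<close> is below 1, and Bernoulli's inequality bounds the loss
  \<open>1 - r powr alpha\<close> by \<open>excess\<close>.\<close>

lemma powr_le_excess:
  assumes "0 \<le> f z" "0 \<le> g z" "1 < alpha"
  shows "f z powr alpha \<le> exp (alpha * eps) * g z powr alpha + excess alpha eps f g z * f z powr alpha"
proof -
  have exp: "(exp eps * g z) powr alpha = exp (alpha * eps) * g z powr alpha"
    using assms by (simp add: powr_mult exp_powr_real mult.commute)
  show ?thesis
  proof (cases "f z \<le> exp eps * g z")
    case True
    then have "f z powr alpha \<le> (exp eps * g z) powr alpha"
      using assms by (intro powr_mono2) auto
    with True exp show ?thesis by (simp add: excess_def)
  next
    case False
    moreover have g: "0 \<le> exp eps * g z" using assms by simp
    ultimately have f: "0 < f z" by linarith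
    define r where "r = exp eps * g z / f z"
    have "0 \<le> r" using f g by (simp add: r_def)
    then have "1 - r powr alpha \<le> alpha * (1 - r)"
      using assms by (intro Bernoulli_inequality_powr) auto
    then have "(1 - r powr alpha) * f z powr alpha \<le> alpha * (1 - r) * f z powr alpha"
      by (rule mult_right_mono) simp
    moreover have "r powr alpha * f z powr alpha = exp (alpha * eps) * g z powr alpha"
      using f g exp by (simp add: r_def powr_divide)
    ultimately show ?thesis
      using False by (simp add: excess_def r_def algebra_simps)
  qed
qed

text \<open>Comparing numerators costs \<open>exp (alpha * eps)\<close> and an excess term. Both
  normalising sums lie between \<open>(1 - eta) * c\<close> and \<open>(1 + eta) * c\<close>, so
  comparing denominators costs \<open>exp eps'\<close>.\<close>

lemma selection_prob_le_on_good_event: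
  assumes good: "\<not> bad_event alpha theta eta f \<omega>" "\<not> bad_event alpha theta eta g \<omega>"
    and f: "\<And>z. 0 \<le> f z" and g: "\<And>z. 0 \<le> g z"
    and pos: "0 < theta" "1 < alpha" "0 < eta" "eta < 1"
    and ratio: "1 + eta \<le> exp eps' * (1 - eta)"
  defines "c \<equiv> theta powr (1 - alpha) / (alpha - 1)"
  shows "selection_prob alpha f X \<omega> \<le>
    ennreal (exp (alpha * eps + eps')) * selection_prob alpha g X \<omega> +
    ennreal (1 / ((1 - eta) * c)) * (\<Sum>k. ennreal (excess alpha eps f g (fst \<omega> !! k)) *
      ennreal (trunc_weight alpha theta f (fst \<omega> !! k, ppr_arrival (snd \<omega>) k)))"
proof -
  from selection_prob_good_event[OF good(1) f pos] obtain s where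
    s: "(1 - eta) * c < s" "s < (1 + eta) * c" "0 < s"
    "\<And>k. trunc_weight alpha theta f (fst \<omega> !! k, ppr_arrival (snd \<omega>) k) = point_weight alpha f \<omega> k"
    "\<And>X. selection_prob alpha f X \<omega> = (\<Sum>k. ennreal (point_weight alpha f \<omega> k / s) * indicator X (fst \<omega>, k))"
    unfolding c_def by blast
  from selection_prob_good_event[OF good(2) g pos] obtain s' where
    s': "(1 - eta) * c < s'" "s' < (1 + eta) * c" "0 < s'"
    "\<And>k. trunc_weight alpha theta g (fst \<omega> !! k, ppr_arrival (snd \<omega>) k) = point_weight alpha g \<omega> k"
    "\<And>X. selection_prob alpha g X \<omega> = (\<Sum>k. ennreal (point_weight alpha g \<omega> k / s') * indicator X (fst \<omega>, k))"
    unfolding c_def by blast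
  have c: "0 < c" using pos by (simp add: c_def)
  have c': "0 < (1 - eta) * c" using c pos by simp
  have "s' \<le> (1 + eta) * c" using s' by simp
  also have "\<dots> \<le> exp eps' * (1 - eta) * c"
    using ratio c by (intro mult_right_mono) auto
  also have "\<dots> \<le> exp eps' * s"
    using s(1) by (simp add: mult.assoc)
  finally have s_le: "s' \<le> exp eps' * s" .
  define h where "h k = excess alpha eps f g (fst \<omega> !! k)" for k
  have h: "0 \<le> h k" for k
    unfolding h_def using g pos by (intro excess_nonneg) auto
  let ?wf = "point_weight alpha f \<omega>" and ?wg = "point_weight alpha g \<omega>"
  have real: "?wf k / s \<le> exp (alpha * eps + eps') * (?wg k / s') + 1 / ((1 - eta) * c) * (h k * ?wf k)" for k
  proof -
    have "f (fst \<omega> !! k) powr alpha / ppr_arrival (snd \<omega>) k powr alpha \<le>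
      (exp (alpha * eps) * g (fst \<omega> !! k) powr alpha + excess alpha eps f g (fst \<omega> !! k) * f (fst \<omega> !! k) powr alpha)
        / ppr_arrival (snd \<omega>) k powr alpha"
      using f g pos by (intro divide_right_mono powr_le_excess) auto
    then have "?wf k \<le> exp (alpha * eps) * ?wg k + h k * ?wf k"
      by (simp add: point_weight_def h_def add_divide_distrib)
    then have "?wf k / s \<le> (exp (alpha * eps) * ?wg k + h k * ?wf k) / s"
      using s by (intro divide_right_mono) auto
    also have "\<dots> = exp (alpha * eps) * ?wg k * (1 / s) + 1 / s * (h k * ?wf k)"
      by (simp add: add_divide_distrib)
    \<comment> \<open>In the main term \<open>1 / s\<close> is traded for the other normalising sum;
      in the excess term it is replaced by a deterministic bound, so that Campbell's formula applies
      to what remains.\<close>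
    also have "\<dots> \<le> exp (alpha * eps) * ?wg k * (exp eps' / s') + 1 / ((1 - eta) * c) * (h k * ?wf k)"
    proof (intro add_mono mult_left_mono mult_right_mono)
      show "1 / s \<le> exp eps' / s'"
        using s_le s s' by (simp add: field_simps)
      show "1 / s \<le> 1 / ((1 - eta) * c)"
        using s c' by (intro divide_left_mono) auto
    qed (use h in auto)
    finally show ?thesis by (simp add: exp_add mult_ac)
  qed
  have "selection_prob alpha f X \<omega> \<le> (\<Sum>k. ennreal (exp (alpha * eps + eps')) * (ennreal (?wg k / s') * indicator X (fst \<omega>, k))
      + ennreal (1 / ((1 - eta) * c)) * (ennreal (h k) * ennreal (?wf k)))"
    unfolding s(5)
  proof (intro suminf_le)
    fix k
    have "ennreal (?wf k / s) \<le> ennreal (exp (alpha * eps + eps') * (?wg k / s') + 1 / ((1 - eta) * c) * (h k * ?wf k))"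
      by (rule ennreal_leI[OF real])
    also have "\<dots> = ennreal (exp (alpha * eps + eps')) * ennreal (?wg k / s') + ennreal (1 / ((1 - eta) * c)) * (ennreal (h k) * ennreal (?wf k))"
    proof -
      have "0 \<le> ?wg k / s'" using s'(3) by simp
      moreover have "0 \<le> 1 / ((1 - eta) * c)" using c' by simp
      moreover have "ennreal (a * b + d * (e * i)) = ennreal a * ennreal b + ennreal d * (ennreal e * ennreal i)"
        if "0 \<le> a" "0 \<le> b" "0 \<le> d" "0 \<le> e" "0 \<le> i" for a b d e i :: real
        using that by (simp add: ennreal_mult)
      ultimately show ?thesis using h by (simp only: exp_ge_zero point_weight_nonneg)
    qed
    \<comment> \<open>The indicator is dropped from the excess term, which makes that term
      independent of \<open>X\<close>.\<close>
    finally show "ennreal (?wf k / s) * indicator X (fst \<omega>, k) \<le>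
      ennreal (exp (alpha * eps + eps')) * (ennreal (?wg k / s') * indicator X (fst \<omega>, k))
      + ennreal (1 / ((1 - eta) * c)) * (ennreal (h k) * ennreal (?wf k))"
      by (simp split: split_indicator)
  qed auto
  also have "\<dots> = ennreal (exp (alpha * eps + eps')) * (\<Sum>k. ennreal (?wg k / s') * indicator X (fst \<omega>, k))
      + ennreal (1 / ((1 - eta) * c)) * (\<Sum>k. ennreal (h k) * ennreal (?wf k))"
    by (subst suminf_add[symmetric]) (auto simp only: ennreal_suminf_cmult summableI)
  finally show ?thesis
    unfolding s(4) s'(5) h_def .
qed

text \<open>On the two bad events the selection probability is bounded by 1, which costs their
  probabilities. Elsewhere the pointwise bound is integrated: the excess sum has mean at most
  \<open>c * alpha * delta\<close>, and \<open>c\<close> cancels against the normalisation.\<close>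

lemma nn_integral_selection_prob_le:
  assumes Q: "prob_space Q"
    and f: "f \<in> borel_measurable Q" "\<And>z. 0 \<le> f z" "(\<integral>\<^sup>+z. ennreal (f z) \<partial>Q) = 1"
    and g: "g \<in> borel_measurable Q" "\<And>z. 0 \<le> g z" "(\<integral>\<^sup>+z. ennreal (g z) \<partial>Q) = 1"
    and X: "X \<in> sets (stream_space Q \<Otimes>\<^sub>M count_space UNIV)"
    and hockey: "(\<integral>\<^sup>+z. ennreal (max 0 (f z - exp eps * g z)) \<partial>Q) \<le> ennreal delta"
    and pos: "0 < theta" "1 < alpha" "0 < eta" "eta < 1" "0 \<le> delta"
    and ratio: "1 + eta \<le> exp eps' * (1 - eta)"
  shows "(\<integral>\<^sup>+\<omega>. selection_prob alpha f X \<omega> \<partial>ppr_space Q) \<le>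
    ennreal (exp (alpha * eps + eps')) * (\<integral>\<^sup>+\<omega>. selection_prob alpha g X \<omega> \<partial>ppr_space Q) +
    ennreal (alpha / (1 - eta) * delta + 2 * (theta + (alpha - 1)\<^sup>2 / (theta * eta\<^sup>2)))"
proof -
  note [measurable] = f(1) g(1) X
  define c where "c = theta powr (1 - alpha) / (alpha - 1)"
  have c: "0 < c" using pos by (simp add: c_def)
  define b where "b = theta + (alpha - 1)\<^sup>2 / (theta * eta\<^sup>2)"
  have b: "0 \<le> b" using pos by (simp add: b_def)
  define D where "D \<omega> = (\<Sum>k. ennreal (excess alpha eps f g (fst \<omega> !! k)) *
      ennreal (trunc_weight alpha theta f (fst \<omega> !! k, ppr_arrival (snd \<omega>) k)))" for \<omega>
  have [measurable]: "D \<in> borel_measurable (ppr_space Q)"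
    unfolding D_def by measurable
  let ?B = "\<lambda>f. {\<omega> \<in> space (ppr_space Q). bad_event alpha theta eta f \<omega>}"
  have [measurable]: "?B f \<in> sets (ppr_space Q)" "?B g \<in> sets (ppr_space Q)"
    by measurable
  have "(\<integral>\<^sup>+\<omega>. selection_prob alpha f X \<omega> \<partial>ppr_space Q) \<le>
    (\<integral>\<^sup>+\<omega>. ennreal (exp (alpha * eps + eps')) * selection_prob alpha g X \<omega> +
      (ennreal (1 / ((1 - eta) * c)) * D \<omega> + (indicator (?B f) \<omega> + indicator (?B g) \<omega>)) \<partial>ppr_space Q)"
  proof (rule nn_integral_mono)
    fix \<omega> assume \<omega>: "\<omega> \<in> space (ppr_space Q)"
    show "selection_prob alpha f X \<omega> \<le> ennreal (exp (alpha * eps + eps')) * selection_prob alpha g X \<omega> +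
      (ennreal (1 / ((1 - eta) * c)) * D \<omega> + (indicator (?B f) \<omega> + indicator (?B g) \<omega>))"
    proof (cases "\<omega> \<in> ?B f \<union> ?B g")
      case True
      then have "1 \<le> (indicator (?B f) \<omega> + indicator (?B g) \<omega> :: ennreal)"
        by (auto simp: indicator_def)
      also have "\<dots> \<le> ennreal (exp (alpha * eps + eps')) * selection_prob alpha g X \<omega> +
          (ennreal (1 / ((1 - eta) * c)) * D \<omega> + (indicator (?B f) \<omega> + indicator (?B g) \<omega>))"
        by (intro add_increasing order_refl) auto
      finally show ?thesis
        using selection_prob_le_1 by (rule order_trans[rotated])
    next
      case False
      with \<omega> have "\<not> bad_event alpha theta eta f \<omega>" "\<not> bad_event alpha theta eta g \<omega>"
        by auto
      from selection_prob_le_on_good_event[OF this f(2) g(2) pos(1-4) ratio, of X eps]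
      have "selection_prob alpha f X \<omega> \<le> ennreal (exp (alpha * eps + eps')) * selection_prob alpha g X \<omega> +
        ennreal (1 / ((1 - eta) * c)) * D \<omega>"
        unfolding D_def c_def .
      also have "\<dots> \<le> ennreal (exp (alpha * eps + eps')) * selection_prob alpha g X \<omega> +
          (ennreal (1 / ((1 - eta) * c)) * D \<omega> + (indicator (?B f) \<omega> + indicator (?B g) \<omega>))"
        by (intro add_left_mono add_increasing2) auto
      finally show ?thesis .
    qed
  qed
  also have "\<dots> = ennreal (exp (alpha * eps + eps')) * (\<integral>\<^sup>+\<omega>. selection_prob alpha g X \<omega> \<partial>ppr_space Q) +
      (ennreal (1 / ((1 - eta) * c)) * (\<integral>\<^sup>+\<omega>. D \<omega> \<partial>ppr_space Q) +
      (emeasure (ppr_space Q) (?B f) + emeasure (ppr_space Q) (?B g)))"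
    by (simp add: nn_integral_add nn_integral_cmult)
  also have "\<dots> \<le> ennreal (exp (alpha * eps + eps')) * (\<integral>\<^sup>+\<omega>. selection_prob alpha g X \<omega> \<partial>ppr_space Q) +
      (ennreal (1 / ((1 - eta) * c)) * ennreal (c * (alpha * delta)) + (ennreal b + ennreal b))"
  proof (intro add_mono mult_left_mono order_refl)
    show "emeasure (ppr_space Q) (?B f) \<le> ennreal b" "emeasure (ppr_space Q) (?B g) \<le> ennreal b"
      unfolding b_def by (rule emeasure_bad_event_le; fact)+
    have "(\<integral>\<^sup>+\<omega>. D \<omega> \<partial>ppr_space Q) = ennreal c * (\<integral>\<^sup>+z. ennreal (excess alpha eps f g z) * ennreal (f z) \<partial>Q)"
      unfolding D_def c_def using f(2) pos by (intro trunc_sum_weighted_mean[OF Q]) measurable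
    also have "(\<integral>\<^sup>+z. ennreal (excess alpha eps f g z) * ennreal (f z) \<partial>Q) =
        (\<integral>\<^sup>+z. ennreal alpha * ennreal (max 0 (f z - exp eps * g z)) \<partial>Q)"
    proof (rule nn_integral_cong)
      fix z
      have "ennreal (excess alpha eps f g z) * ennreal (f z) = ennreal (excess alpha eps f g z * f z)"
        using f(2) g(2) pos by (intro ennreal_mult[symmetric] excess_nonneg) auto
      also have "\<dots> = ennreal alpha * ennreal (max 0 (f z - exp eps * g z))"
        unfolding excess_mult[where g=g and z=z, OF g(2)] using pos by (intro ennreal_mult) auto
      finally show "ennreal (excess alpha eps f g z) * ennreal (f z) = ennreal alpha * ennreal (max 0 (f z - exp eps * g z))" .
    qed
    also have "\<dots> = ennreal alpha * (\<integral>\<^sup>+z. ennreal (max 0 (f z - exp eps * g z)) \<partial>Q)"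
      by (rule nn_integral_cmult) measurable
    also have "ennreal c * \<dots> \<le> ennreal c * (ennreal alpha * ennreal delta)"
      by (intro mult_left_mono hockey) auto
    also have "\<dots> = ennreal (c * (alpha * delta))"
      using c pos by (simp add: ennreal_mult)
    finally show "(\<integral>\<^sup>+\<omega>. D \<omega> \<partial>ppr_space Q) \<le> ennreal (c * (alpha * delta))" .
  qed auto
  also have "ennreal (1 / ((1 - eta) * c)) * ennreal (c * (alpha * delta)) + (ennreal b + ennreal b) =
      ennreal (alpha / (1 - eta) * delta + 2 * b)"
  proof -
    have "ennreal (1 / ((1 - eta) * c)) * ennreal (c * (alpha * delta)) =
        ennreal (1 / ((1 - eta) * c) * (c * (alpha * delta)))"
      using c pos by (intro ennreal_mult[symmetric]) auto
    also have "1 / ((1 - eta) * c) * (c * (alpha * delta)) = alpha / (1 - eta) * delta"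
    proof -
      have "1 / (d * c) * (c * (alpha * delta)) = alpha / d * delta" if "0 < d" for d
        using c that by (simp add: field_simps)
      then show ?thesis using pos by simp
    qed
    finally have "ennreal (1 / ((1 - eta) * c)) * ennreal (c * (alpha * delta)) = ennreal (alpha / (1 - eta) * delta)" .
    moreover have "0 \<le> alpha / (1 - eta) * delta" using pos by simp
    moreover have "ennreal d + (ennreal b + ennreal b) = ennreal (d + 2 * b)" if "0 \<le> d" for d
      using b that by (simp only: mult_2 ennreal_plus add_nonneg_nonneg)
    ultimately show ?thesis by (simp only:)
  qed
  finally show ?thesis unfolding b_def .
qed

section \<open>Choice of constants and conclusion\<close>

text \<open>The form in which the bound on \<open>alpha\<close> enters:
  \<open>delta' \<le> 1/3 < 1/e\<close> gives \<open>- ln delta' \<ge> 1\<close>, the quadratic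
  Taylor bound gives \<open>exp 4.2 \<ge> 6\<close>, and one factor \<open>eps' \<le> 1\<close> is
  given away.\<close>

lemma alpha_minus_one_le:
  fixes alpha delta' eps' :: real
  assumes "0 < eps'" "eps' \<le> 1" "0 < delta'" "delta' \<le> 1/3" "alpha > 1"
    and "alpha \<le> exp (- 42/10) * delta' * eps'^2 / (- ln delta') + 1"
  shows "alpha - 1 \<le> delta' * eps' / 6"
proof -
  have "(1::real) \<le> ln 3"
    using exp_le by (subst ln_ge_iff) auto
  moreover have "ln delta' \<le> ln (1 / 3)"
    using assms by (subst ln_le_cancel_iff) auto
  ultimately have ln: "1 \<le> - ln delta'"
    by (simp add: ln_div)
  have "6 \<le> 1 + 42/10 + (42/10)\<^sup>2 / (2::real)"
    by (simp add: power2_eq_square)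
  also have "\<dots> \<le> exp (42/10)"
    by (rule exp_lower_Taylor_quadratic) simp
  finally have "inverse (exp (42/10)) \<le> inverse (6::real)"
    by (intro le_imp_inverse_le) auto
  then have exp: "exp (- 42/10) \<le> 1 / (6::real)"
    by (simp add: exp_minus inverse_eq_divide)
  have "alpha - 1 \<le> exp (- 42/10) * delta' * eps'^2 / (- ln delta')"
    using assms by simp
  also have "\<dots> \<le> exp (- 42/10) * delta' * eps'^2 / 1"
    using ln assms by (intro divide_left_mono) auto
  also have "\<dots> \<le> 1 / 6 * delta' * eps'^2 / 1"
    using exp assms by (intro divide_right_mono mult_right_mono) auto
  also have "\<dots> \<le> 1 / 6 * delta' * eps' / 1"
    using assms by (intro divide_right_mono mult_left_mono) (auto simp: power2_eq_square)
  finally show ?thesis by simp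
qed

theorem theorem5:
  fixes N :: "('x \<times> 'x) set"
    and Q :: "'z measure"
    and PZX :: "'x \<Rightarrow> 'z measure"
    and eps delta eps' delta' alpha :: real
  assumes "sym N"
    and "prob_space Q"
    and "\<And>x. prob_space (PZX x)"
    and "\<And>x. sets (PZX x) = sets Q"
    and "\<And>x. absolutely_continuous Q (PZX x)"
    and "dp eps delta N PZX"
    and "0 < eps'" and "eps' \<le> 1"
    and "0 < delta'" and "delta' \<le> 1/3"
    and "alpha > 1"
    and "alpha \<le> exp (- 42/10) * delta' * eps'^2 / (- ln delta') + 1"
  shows "dp (alpha * eps + eps') (2 * (delta + delta')) N (ppr_mech Q PZX alpha)"
  unfolding dp_def
proof (intro ballI, clarify)
  fix x x' X assume N: "(x, x') \<in> N" and "X \<in> sets (ppr_mech Q PZX alpha x)"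
  then have X: "X \<in> sets (stream_space Q \<Otimes>\<^sub>M count_space UNIV)"
    using assms by (simp add: sets_ppr_mech)
  interpret M: prob_space "ppr_space Q" by (rule prob_space_ppr_space) fact
  define f where "f y z = enn2real (RN_deriv Q (PZX y) z)" for y z
  have f: "f y \<in> borel_measurable Q" "0 \<le> f y z" for y z
    unfolding f_def by auto
  have density: "density Q (\<lambda>z. ennreal (f y z)) = PZX y" for y
    unfolding f_def using assms by (intro density_enn2real_RN_deriv) auto
  have f_1: "(\<integral>\<^sup>+z. ennreal (f y z) \<partial>Q) = 1" for y
  proof -
    have "emeasure (density Q (\<lambda>z. ennreal (f y z))) (space Q) = (\<integral>\<^sup>+z. ennreal (f y z) \<partial>Q)"
      using f(1)[of y] by (subst emeasure_density) (auto intro!: nn_integral_cong simp: indicator_def)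
    moreover have "space (PZX y) = space Q" using assms(4) by (rule sets_eq_imp_space_eq)
    ultimately show ?thesis
      using prob_space.emeasure_space_1[OF assms(3), of y] by (simp add: density)
  qed
  have dp: "measure (PZX x) A \<le> exp eps * measure (PZX x') A + delta" if "A \<in> sets Q" for A
    using assms(6) N that assms(4)[of x] unfolding dp_def by fastforce
  have delta: "0 \<le> delta" using dp[of "{}"] by simp
  have hockey: "(\<integral>\<^sup>+z. ennreal (max 0 (f x z - exp eps * f x' z)) \<partial>Q) \<le> ennreal delta"
    by (rule nn_integral_hockey_stick_le)
      (use f dp assms(3) in \<open>auto simp: density intro: prob_space.finite_measure\<close>)
  \<comment> \<open>With these values early arrivals and the Chebyshev term each cost at most
    \<open>delta' / 2\<close>, so the two bad events together cost at most
    \<open>2 * delta'\<close>.\<close>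
  define theta where "theta = delta' / 2"
  define eta where "eta = eps' / 3"
  have pos: "0 < theta" "0 < eta" "eta < 1"
    using assms by (auto simp: theta_def eta_def)
  have alpha: "alpha - 1 \<le> delta' * eps' / 6"
    by (rule alpha_minus_one_le) fact+
  have "delta' * eps' \<le> 1/3 * 1"
    using assms by (intro mult_mono) auto
  with alpha have alpha_le: "alpha \<le> 4/3" by simp
  have "eps' * eps' \<le> eps'"
    using mult_left_mono[of eps' 1 eps'] assms(7,8) by simp
  \<comment> \<open>For \<open>eta = eps' / 3\<close> this inequality is exactly
    \<open>eps' * eps' \<le> eps'\<close>.\<close>
  then have "1 + eta \<le> (1 + eps') * (1 - eta)"
    by (simp add: eta_def field_simps)
  also have "\<dots> \<le> exp eps' * (1 - eta)"
    using pos by (intro mult_right_mono) auto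
  finally have ratio: "1 + eta \<le> exp eps' * (1 - eta)" .
  \<comment> \<open>Here \<open>alpha \<le> 4/3\<close> meets \<open>1 - eta \<ge> 2/3\<close>,
    which produces the factor 2 in front of \<open>delta\<close>.\<close>
  have "alpha / (1 - eta) \<le> 2"
    using alpha_le assms(7,8) by (simp add: eta_def field_simps)
  then have 1: "alpha / (1 - eta) * delta \<le> 2 * delta"
    using delta by (intro mult_right_mono)
  have "(alpha - 1)\<^sup>2 \<le> (delta' * eps' / 6)\<^sup>2"
    using alpha assms(11) by (intro power_mono) auto
  then have "(alpha - 1)\<^sup>2 / (theta * eta\<^sup>2) \<le> (delta' * eps' / 6)\<^sup>2 / (theta * eta\<^sup>2)"
    using pos by (intro divide_right_mono) auto
  also have "\<dots> = delta' / 2"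
    using assms(7,9) by (simp add: theta_def eta_def power2_eq_square field_simps)
  finally have 2: "2 * (theta + (alpha - 1)\<^sup>2 / (theta * eta\<^sup>2)) \<le> 2 * delta'"
    by (simp add: theta_def)
  let ?I = "\<lambda>y. \<integral>\<^sup>+\<omega>. selection_prob alpha (f y) X \<omega> \<partial>ppr_space Q"
  \<comment> \<open>Finiteness of \<open>?I\<close> allows the integrals to be rewritten as
    real-valued measures of the mechanism.\<close>
  have "?I y \<le> (\<integral>\<^sup>+\<omega>. 1 \<partial>ppr_space Q)" for y
    by (intro nn_integral_mono selection_prob_le_1)
  then have "?I y < \<infinity>" for y
    by (rule le_less_trans) (simp add: M.emeasure_space_1)
  then have I: "?I y = ennreal (measure (ppr_mech Q PZX alpha y) X)" for y
    using emeasure_ppr_mech[OF assms(2) X, of PZX alpha y, folded f_def]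
    by (simp add: measure_def)
  have "?I x \<le> ennreal (exp (alpha * eps + eps')) * ?I x' +
      ennreal (alpha / (1 - eta) * delta + 2 * (theta + (alpha - 1)\<^sup>2 / (theta * eta\<^sup>2)))"
    by (rule nn_integral_selection_prob_le) (fact | rule f f_1)+
  also have "\<dots> \<le> ennreal (exp (alpha * eps + eps')) * ?I x' + ennreal (2 * (delta + delta'))"
    using 1 2 by (intro add_left_mono ennreal_leI) simp
  also have "\<dots> = ennreal (exp (alpha * eps + eps') * measure (ppr_mech Q PZX alpha x') X + 2 * (delta + delta'))"
    unfolding I using delta assms(9) by (subst ennreal_plus) (auto simp: ennreal_mult)
  finally show "measure (ppr_mech Q PZX alpha x) X \<le>
      exp (alpha * eps + eps') * measure (ppr_mech Q PZX alpha x') X + 2 * (delta + delta')"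
    unfolding I using delta assms(9) by (subst (asm) ennreal_le_iff) auto
qed

end
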